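(* Let $C_{10}^{03},C_{01}^{03},C_{11}^{03},C_{10}^{12},C_{20}^{12},C_{01}^{12},C_{11}^{12}\in\mathbb{C}$ and let $\omega_{\lambda(1)}$ be the $1$-form attached to the partition $\lambda(1)=(3^2,1)$ of $7$ and the leading terms $LT=\{y^3,-z^3,yz^2\}$, with local representation $f\,dy+g\,dz$ at $[1:0:0]$ given by $$f=-C_{10}^{03}y-y^{2}-C_{01}^{03}z-C_{11}^{03}yz+C_{11}^{12}z^{2}-z^{3},$$ $$g=-C_{10}^{12}y-C_{20}^{12}y^{2}-C_{01}^{12}z-C_{11}^{12}yz+yz^{2}.$$ Assume that the algebraic multiplicity satisfies $m_{[1:0:0]}(\omega_{\lambda(1)})=2$. Then $$4\leq I_0(f,g)\leq 7 .$$ Moreover, $I_0(f,g)=7$ in each of the following cases: (1) $f_1=g_1=0$, $C_{11}^{12}=0$ and $C_{20}^{12}=-C_{11}^{03}\neq 0$; (2) $f_1=g_1=0$ and $C_{20}^{12}=C_{11}^{12}=0$.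
   Context: The form is $\omega_{\lambda(1)}=A\,dx+B\,dy+C\,dz$ on $\mathbb{CP}^2$, where $A,B,C\in\mathbb{C}[x,y,z]$ are homogeneous of degree $3$ with $xA+yB+zC=0$; $B,C$ are the homogenizations of $f,g$ to degree $3$ with respect to $x$ (so $f=B(1,y,z)$, $g=C(1,y,z)$), and $A$ is determined by the Euler relation. The point $[1:0:0]$ is a zero of $A,B,C$. Write $f=f_1+f_2+f_3$, $g=g_1+g_2+g_3$ with $f_i,g_i\in\mathbb{C}[y,z]$ homogeneous of degree $i$. The algebraic multiplicity $m_{[1:0:0]}(\omega)$ is $\min\{m,s\}$, where $m$ (resp. $s$) is the lowest degree of a nonzero homogeneous component of $f$ (resp. $g$). $I_0(f,g)=\dim_{\mathbb{C}}\mathcal{O}_{\mathbb{C}^2,(0,0)}/\langle f,g\rangle$ is the intersection index of $f$ and $g$ at the origin ($\infty$ if the dimension is infinite). *)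

theory Defs
  imports
    "HOL-Analysis.Analysis"
    "HOL-Library.Poly_Mapping"
    "HOL-Library.Extended_Nat"
    "HOL-Algebra.QuotRing"
    "HOL-Algebra.Embedded_Algebras"
    "HOL-Algebra.Algebraic_Closure_Type"
begin

section \<open>Polynomials in two and three variables\<close>

text \<open>
  A polynomial is a finitely supported map from exponent vectors to coefficients: the exponent
  \<open>(i, j)\<close> stands for $y^i z^j$ and \<open>(k, i, j)\<close> for $x^k y^i z^j$. The ring structure is the
  convolution product of \<^theory>\<open>HOL-Library.Poly_Mapping\<close>.
\<close>

type_synonym poly_yz = "(nat \<times> nat) \<Rightarrow>\<^sub>0 complex"
type_synonym poly_xyz = "(nat \<times> nat \<times> nat) \<Rightarrow>\<^sub>0 complex"

definition const_yz :: "complex \<Rightarrow> poly_yz" where "const_yz c = Poly_Mapping.single (0, 0) c"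
definition var_y :: poly_yz where "var_y = Poly_Mapping.single (1, 0) 1"
definition var_z :: poly_yz where "var_z = Poly_Mapping.single (0, 1) 1"

definition var_X :: poly_xyz where "var_X = Poly_Mapping.single (1, 0, 0) 1"
definition var_Y :: poly_xyz where "var_Y = Poly_Mapping.single (0, 1, 0) 1"
definition var_Z :: poly_xyz where "var_Z = Poly_Mapping.single (0, 0, 1) 1"

definition eval_yz :: "poly_yz \<Rightarrow> complex \<times> complex \<Rightarrow> complex" where
  "eval_yz p = (\<lambda>(y, z).
     \<Sum>(i, j) \<in> Poly_Mapping.keys p. Poly_Mapping.lookup p (i, j) * y ^ i * z ^ j)"

definition hom_component :: "nat \<Rightarrow> poly_yz \<Rightarrow> poly_yz" where
  "hom_component d p =
     (\<Sum>(i, j) \<in> {(i, j) \<in> Poly_Mapping.keys p. i + j = d}.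
        Poly_Mapping.single (i, j) (Poly_Mapping.lookup p (i, j)))"

text \<open>The infimum of the empty set in \<^typ>\<open>enat\<close> is \<open>\<infinity>\<close>, the value for the zero polynomial.\<close>

definition lowest_degree :: "poly_yz \<Rightarrow> enat" where
  "lowest_degree p = Inf (enat ` {d. hom_component d p \<noteq> 0})"

definition homogeneous_xyz :: "nat \<Rightarrow> poly_xyz \<Rightarrow> bool" where
  "homogeneous_xyz d P \<longleftrightarrow> (\<forall>(k, i, j) \<in> Poly_Mapping.keys P. k + i + j = d)"

text \<open>Meant for polynomials of total degree at most \<open>d\<close> (the subtraction is truncated).\<close>

definition homogenize :: "nat \<Rightarrow> poly_yz \<Rightarrow> poly_xyz" where
  "homogenize d p =
     (\<Sum>(i, j) \<in> Poly_Mapping.keys p.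
        Poly_Mapping.single (d - (i + j), i, j) (Poly_Mapping.lookup p (i, j)))"

text \<open>Substitution of $x = 1$.\<close>

definition dehomogenize :: "poly_xyz \<Rightarrow> poly_yz" where
  "dehomogenize P =
     (\<Sum>(k, i, j) \<in> Poly_Mapping.keys P.
        Poly_Mapping.single (i, j) (Poly_Mapping.lookup P (k, i, j)))"


section \<open>One-forms on the projective plane\<close>

text \<open>The triple \<open>(A, B, C)\<close> stands for the form $A\,dx + B\,dy + C\,dz$.\<close>

type_synonym form_xyz = "poly_xyz \<times> poly_xyz \<times> poly_xyz"

definition projective_form :: "nat \<Rightarrow> form_xyz \<Rightarrow> bool" where
  "projective_form d = (\<lambda>(A, B, C).
     homogeneous_xyz d A \<and> homogeneous_xyz d B \<and> homogeneous_xyz d C \<and>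
     var_X * A + var_Y * B + var_Z * C = 0)"

definition alg_multiplicity_100 :: "form_xyz \<Rightarrow> enat" where
  "alg_multiplicity_100 = (\<lambda>(A, B, C).
     min (lowest_degree (dehomogenize B)) (lowest_degree (dehomogenize C)))"


section \<open>The local ring of the complex plane at the origin\<close>

text \<open>
  A function of two complex variables is holomorphic near the origin if at every nearby point it
  has a total derivative that is complex linear.
\<close>

definition holomorphic_at_0 :: "(complex \<times> complex \<Rightarrow> complex) \<Rightarrow> bool" where
  "holomorphic_at_0 F \<longleftrightarrow>
     (\<forall>\<^sub>F p in nhds (0, 0). \<exists>a b. (F has_derivative (\<lambda>(u, v). a * u + b * v)) (at p))"

definition germ_rel ::
    "(complex \<times> complex \<Rightarrow> complex) \<Rightarrow> (complex \<times> complex \<Rightarrow> complex) \<Rightarrow> bool" where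
  "germ_rel F G \<longleftrightarrow>
     holomorphic_at_0 F \<and> holomorphic_at_0 G \<and> (\<forall>\<^sub>F p in nhds (0, 0). F p = G p)"

lemma holomorphic_at_0_const: "holomorphic_at_0 (\<lambda>p. c)"
  unfolding holomorphic_at_0_def
  by (intro always_eventually allI exI[of _ 0]) (auto intro!: derivative_eq_intros)

lemma holomorphic_at_0_fst: "holomorphic_at_0 fst"
  unfolding holomorphic_at_0_def
  by (intro always_eventually allI exI[of _ 1] exI[of _ 0])
     (auto intro!: derivative_eq_intros simp: case_prod_unfold)

lemma holomorphic_at_0_snd: "holomorphic_at_0 snd"
  unfolding holomorphic_at_0_def
  by (intro always_eventually allI exI[of _ 0] exI[of _ 1])
     (auto intro!: derivative_eq_intros simp: case_prod_unfold)

lemma holomorphic_at_0_uminus: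
  assumes "holomorphic_at_0 F"
  shows "holomorphic_at_0 (\<lambda>p. - F p)"
  using assms unfolding holomorphic_at_0_def
proof eventually_elim
  case (elim p)
  then obtain a b where F: "(F has_derivative (\<lambda>(u, v). a * u + b * v)) (at p)" by blast
  show ?case
    by (rule exI[of _ "- a"], rule exI[of _ "- b"], rule has_derivative_eq_rhs,
        rule has_derivative_minus[OF F]) (auto simp: fun_eq_iff algebra_simps)
qed

lemma holomorphic_at_0_add:
  assumes "holomorphic_at_0 F" "holomorphic_at_0 G"
  shows "holomorphic_at_0 (\<lambda>p. F p + G p)"
  using assms unfolding holomorphic_at_0_def
proof eventually_elim
  case (elim p)
  then obtain a b c d where F: "(F has_derivative (\<lambda>(u, v). a * u + b * v)) (at p)"
    and G: "(G has_derivative (\<lambda>(u, v). c * u + d * v)) (at p)" by blast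
  show ?case
    by (rule exI[of _ "a + c"], rule exI[of _ "b + d"], rule has_derivative_eq_rhs,
        rule has_derivative_add[OF F G]) (auto simp: fun_eq_iff algebra_simps)
qed

lemma holomorphic_at_0_mult:
  assumes "holomorphic_at_0 F" "holomorphic_at_0 G"
  shows "holomorphic_at_0 (\<lambda>p. F p * G p)"
  using assms unfolding holomorphic_at_0_def
proof eventually_elim
  case (elim p)
  then obtain a b c d where F: "(F has_derivative (\<lambda>(u, v). a * u + b * v)) (at p)"
    and G: "(G has_derivative (\<lambda>(u, v). c * u + d * v)) (at p)" by blast
  show ?case
    by (rule exI[of _ "F p * c + a * G p"], rule exI[of _ "F p * d + b * G p"],
        rule has_derivative_eq_rhs, rule has_derivative_mult[OF F G])
       (auto simp: fun_eq_iff algebra_simps)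
qed

lemma holomorphic_at_0_power:
  "holomorphic_at_0 F \<Longrightarrow> holomorphic_at_0 (\<lambda>p. F p ^ n)"
  by (induction n) (simp_all add: holomorphic_at_0_const holomorphic_at_0_mult)

lemma holomorphic_at_0_sum:
  "(\<And>i. i \<in> I \<Longrightarrow> holomorphic_at_0 (F i)) \<Longrightarrow> holomorphic_at_0 (\<lambda>p. \<Sum>i\<in>I. F i p)"
  by (induction I rule: infinite_finite_induct)
     (simp_all add: holomorphic_at_0_const holomorphic_at_0_add)

lemma holomorphic_at_0_eval: "holomorphic_at_0 (eval_yz p)"
proof -
  have "eval_yz p = (\<lambda>q. \<Sum>k\<in>Poly_Mapping.keys p. Poly_Mapping.lookup p k * fst q ^ fst k * snd q ^ snd k)"
    by (simp add: eval_yz_def fun_eq_iff case_prod_unfold)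
  then show ?thesis
    by (auto intro!: holomorphic_at_0_sum holomorphic_at_0_mult holomorphic_at_0_const
        holomorphic_at_0_power holomorphic_at_0_fst holomorphic_at_0_snd)
qed

quotient_type germ = "complex \<times> complex \<Rightarrow> complex" / partial: germ_rel
proof (rule part_equivpI)
  show "\<exists>F. germ_rel F F"
    by (rule exI[of _ "\<lambda>_. 0"]) (simp add: germ_rel_def holomorphic_at_0_const)
  show "symp germ_rel"
    by (auto simp: symp_def germ_rel_def elim!: eventually_mono)
  show "transp germ_rel"
    unfolding transp_def germ_rel_def by (auto elim: eventually_elim2)
qed

instantiation germ :: comm_ring_1
begin

lift_definition zero_germ :: germ is "\<lambda>_. 0"
  by (simp add: germ_rel_def holomorphic_at_0_const)

lift_definition one_germ :: germ is "\<lambda>_. 1"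
  by (simp add: germ_rel_def holomorphic_at_0_const)

lift_definition plus_germ :: "germ \<Rightarrow> germ \<Rightarrow> germ" is "\<lambda>F G p. F p + G p"
  unfolding germ_rel_def by (auto intro: holomorphic_at_0_add elim: eventually_elim2)

lift_definition uminus_germ :: "germ \<Rightarrow> germ" is "\<lambda>F p. - F p"
  unfolding germ_rel_def by (auto intro: holomorphic_at_0_uminus elim: eventually_mono)

lift_definition times_germ :: "germ \<Rightarrow> germ \<Rightarrow> germ" is "\<lambda>F G p. F p * G p"
  unfolding germ_rel_def by (auto intro: holomorphic_at_0_mult elim: eventually_elim2)

definition minus_germ :: "germ \<Rightarrow> germ \<Rightarrow> germ" where
  "minus_germ a b = a + - b"

instance
proof
  fix a b c :: germ
  show "a * b * c = a * (b * c)" "a * b = b * a" "1 * a = a" "a + b + c = a + (b + c)"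
    "a + b = b + a" "0 + a = a" "- a + a = 0" "(a + b) * c = a * c + b * c"
    by (transfer; simp add: germ_rel_def algebra_simps holomorphic_at_0_const
        holomorphic_at_0_add holomorphic_at_0_mult holomorphic_at_0_uminus)+
  show "a - b = a + - b" by (simp add: minus_germ_def)
  show "(0 :: germ) \<noteq> 1" by transfer (simp add: germ_rel_def)
qed

end

lift_definition germ_const :: "complex \<Rightarrow> germ" is "\<lambda>c _. c"
  by (simp add: germ_rel_def holomorphic_at_0_const)

lift_definition germ_of_poly :: "poly_yz \<Rightarrow> germ" is eval_yz
  by (simp add: germ_rel_def holomorphic_at_0_eval)

definition germ_ring :: "germ ring" where
  "germ_ring = ring_of_type_algebra"

lemma cring_germ_ring: "cring germ_ring"
  unfolding germ_ring_def by (rule cring_from_type_algebra)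


section \<open>The intersection index at the origin\<close>

text \<open>
  The quotient of the local ring by the ideal generated by two germs is a vector space over the
  image of the constant germs. The relation \<^const>\<open>ring.dimension\<close> holds of at most one natural
  number, and of none if that vector space is not finite dimensional. If the ideal is the whole
  ring, the dimension is 0.
\<close>

definition intersection_index :: "poly_yz \<Rightarrow> poly_yz \<Rightarrow> enat" where
  "intersection_index f g =
     (let I = genideal germ_ring {germ_of_poly f, germ_of_poly g};
          Q = germ_ring Quot I;
          K = range (\<lambda>c. I +>\<^bsub>germ_ring\<^esub> germ_const c);
          is_dim = (\<lambda>n. ring.dimension Q n K (carrier Q))
      in if \<exists>n. is_dim n then enat (THE n. is_dim n) else \<infinity>)"

end

theory Submission
  imports Defs "HOL-Complex_Analysis.Complex_Analysis"
begin

text \<open>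
  Multiplicity 2 forces the linear parts to vanish. Writing \<open>a = C03_11\<close>, \<open>b = C12_20\<close>,
  \<open>c = C12_11\<close>, one has \<open>g = y h\<close> with \<open>h = z\<^sup>2 - c z - b y\<close>, so the index is
  \<open>I(f, y) + I(f, h)\<close>. On the line \<open>y = 0\<close>, \<open>f\<close> is \<open>z\<^sup>2 (c - z)\<close>. If \<open>b \<noteq> 0\<close>, eliminating \<open>y\<close> on
  the curve \<open>h = 0\<close> turns \<open>b\<^sup>2 f\<close> into \<open>- z\<^sup>2 (z - c) (z + b\<^sup>2 + a b - c)\<close>; if \<open>b = 0\<close>, \<open>h\<close> is
  \<open>z (z - c)\<close> and \<open>f\<close> is \<open>- y\<^sup>2\<close> on \<open>z = 0\<close>. Additivity of the index reduces every case to
  \<open>I(y, z) = 1\<close>. The one analytic input is that a germ vanishing on \<open>y = 0\<close> is divisible by \<open>y\<close>.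
\<close>

section \<open>Finite extensions by one-dimensional steps\<close>

text \<open>A relative version of the inductive \<open>dimension\<close> of HOL-Algebra: the chain
  starts at \<open>A\<close> instead of the zero space, so for an ideal \<open>A\<close> it counts
  dimensions modulo \<open>A\<close> inside the ring itself.\<close>

inductive extends :: "'a::comm_ring_1 set \<Rightarrow> 'a set \<Rightarrow> nat \<Rightarrow> 'a set \<Rightarrow> bool" for K A where
  extends_refl: "extends K A 0 A"
| extends_step: "extends K A n E \<Longrightarrow> v \<notin> E \<Longrightarrow> extends K A (Suc n) {c * v + e | c e. c \<in> K \<and> e \<in> E}"

lemma extends_trans:
  assumes "extends K B n C" "extends K A m B"
  shows "extends K A (m + n) C"
  using assms by (induction rule: extends.induct) (auto intro: extends.intros)

text \<open>No vector lies outside \<open>UNIV\<close>, so no step is possible. This later excludes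
  the zero quotient when \<open>n\<close> is positive.\<close>

lemma extends_UNIV: "extends K UNIV n E \<Longrightarrow> n = 0 \<and> E = UNIV"
  by (induction rule: extends.induct) auto

section \<open>Colength of an ideal with two generators\<close>

definition pair_ideal :: "'a::comm_ring_1 \<Rightarrow> 'a \<Rightarrow> 'a set" where
  "pair_ideal f g = {u * f + v * g | u v. True}"

text \<open>For \<open>K\<close> the constants this is the dimension of the ring modulo
  \<open>(f, g)\<close>, kept as a relation so that uniqueness can wait for the comparison with
  \<open>dimension\<close>.\<close>

definition colength :: "'a::comm_ring_1 set \<Rightarrow> 'a \<Rightarrow> 'a \<Rightarrow> nat \<Rightarrow> bool" where
  "colength K f g n \<longleftrightarrow> extends K (pair_ideal f g) n UNIV"

lemma pair_ideal_iff: "x \<in> pair_ideal f g \<longleftrightarrow> (\<exists>u v. x = u * f + v * g)"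
  by (auto simp: pair_ideal_def)

lemma pair_ideal_eqI:
  assumes "f \<in> pair_ideal f' g'" "g \<in> pair_ideal f' g'"
    and "f' \<in> pair_ideal f g" "g' \<in> pair_ideal f g"
  shows "pair_ideal f g = pair_ideal f' g'"
proof -
  have "pair_ideal a b \<subseteq> pair_ideal a' b'"
    if ab: "a \<in> pair_ideal a' b'" "b \<in> pair_ideal a' b'" for a b a' b' :: 'a
  proof
    fix x assume "x \<in> pair_ideal a b"
    then obtain u v where x: "x = u * a + v * b" by (auto simp: pair_ideal_iff)
    from ab obtain p q r s where "a = p * a' + q * b'" "b = r * a' + s * b'"
      by (auto simp: pair_ideal_iff)
    with x have "x = (u * p + v * r) * a' + (u * q + v * s) * b'"
      by (simp add: algebra_simps)
    then show "x \<in> pair_ideal a' b'" by (auto simp: pair_ideal_iff)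
  qed
  with assms show ?thesis by blast
qed

lemma colength_swap: "colength K f g n \<longleftrightarrow> colength K g f n"
proof -
  have "pair_ideal f g = pair_ideal g f"
    by (auto simp: pair_ideal_def) (metis add.commute)+
  then show ?thesis by (simp add: colength_def)
qed

text \<open>Modulo \<open>f\<close>, \<open>g'\<close> is a unit times \<open>g\<close>, so both
  pairs generate the same ideal. This is the rule for eliminating a variable along the curve
  \<open>f = 0\<close>.\<close>

lemma colength_cong:
  assumes "g' = e * g + u * f" "e dvd 1"
  shows "colength K f g n \<longleftrightarrow> colength K f g' n"
proof -
  from assms(2) obtain e' where e: "1 = e * e'" by auto
  have g: "g = (- e' * u) * f + e' * g'"
  proof -
    have "(- e' * u) * f + e' * g' = (e * e') * g" by (simp add: assms(1) algebra_simps)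
    then show ?thesis using e by simp
  qed
  have "pair_ideal f g = pair_ideal f g'"
  proof (rule pair_ideal_eqI)
    show "f \<in> pair_ideal f g'" "f \<in> pair_ideal f g"
      unfolding pair_ideal_iff by (rule exI[of _ 1], rule exI[of _ 0], simp)+
    show "g \<in> pair_ideal f g'" using g unfolding pair_ideal_iff by blast
    show "g' \<in> pair_ideal f g" using assms(1) unfolding pair_ideal_iff by (metis add.commute)
  qed
  then show ?thesis by (simp add: colength_def)
qed

lemma colength_unit:
  assumes "g dvd 1"
  shows "colength K f g 0"
proof -
  from assms obtain g' where "1 = g * g'" by auto
  then have "x = 0 * f + (x * g') * g" for x
    by (metis add.left_neutral mult.assoc mult.commute mult.right_neutral mult_zero_left)
  then have "pair_ideal f g = UNIV" unfolding pair_ideal_iff set_eq_iff by blast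
  then show ?thesis by (simp add: colength_def extends_refl)
qed

text \<open>Multiplication by \<open>g\<close> embeds the quotient by \<open>(f, h)\<close> into the quotient by \<open>(f, g h)\<close>,
  with cokernel the quotient by \<open>(f, g)\<close>.\<close>

lemma colength_mult:
  assumes dvd: "\<And>u v. u * f = v * g \<Longrightarrow> g dvd u"
    and cancel: "\<And>u v. g * u = g * v \<Longrightarrow> u = v"
    and "colength K f g m" "colength K f h n"
  shows "colength K f (g * h) (n + m)"
proof -
  \<comment> \<open>\<open>\<phi>\<close> is multiplication by \<open>g\<close> modulo
    \<open>f\<close>, acting on sets: it carries the chain from \<open>(f, h)\<close> up to the ring
    into a chain from \<open>(f, g h)\<close> up to \<open>(f, g)\<close>.\<close>
  define \<phi> where "\<phi> E = {u * f + g * e | u e. e \<in> E}" for E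
  \<comment> \<open>Stability under adding multiples of \<open>f\<close> is carried along: it is
    what keeps a new vector new after multiplication by \<open>g\<close>.\<close>
  have ext: "extends K (pair_ideal f (g * h)) k (\<phi> E) \<and> (\<forall>e\<in>E. \<forall>u. e + u * f \<in> E)"
    if "extends K (pair_ideal f h) k E" for k E
    using that
  proof (induction rule: extends.induct)
    case extends_refl
    have "\<phi> (pair_ideal f h) = pair_ideal f (g * h)"
    proof (intro equalityI subsetI)
      fix x assume "x \<in> \<phi> (pair_ideal f h)"
      then obtain u a b where "x = u * f + g * (a * f + b * h)"
        by (auto simp: \<phi>_def pair_ideal_iff)
      then have "x = (u + g * a) * f + b * (g * h)" by (simp add: algebra_simps)
      then show "x \<in> pair_ideal f (g * h)" by (auto simp: pair_ideal_iff)
    next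
      fix x assume "x \<in> pair_ideal f (g * h)"
      then obtain a b where "x = a * f + b * (g * h)" by (auto simp: pair_ideal_iff)
      then have "x = a * f + g * (0 * f + b * h)" by (simp add: algebra_simps)
      then show "x \<in> \<phi> (pair_ideal f h)" unfolding \<phi>_def pair_ideal_iff by blast
    qed
    moreover have "e + u * f \<in> pair_ideal f h" if e: "e \<in> pair_ideal f h" for e u
    proof -
      from e obtain a b where "e = a * f + b * h" by (auto simp: pair_ideal_iff)
      then have "e + u * f = (a + u) * f + b * h" by (simp add: algebra_simps)
      then show ?thesis by (auto simp: pair_ideal_iff)
    qed
    ultimately show ?case by (simp add: extends.extends_refl)
  next
    case (extends_step k E v)
    have "g * v \<notin> \<phi> E"
    proof
      assume "g * v \<in> \<phi> E"
      then obtain u e where e: "e \<in> E" and ue: "g * v = u * f + g * e" by (auto simp: \<phi>_def)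
      then have "u * f = (v - e) * g" by (simp add: algebra_simps)
      \<comment> \<open>Here \<open>f\<close> is a nonzerodivisor modulo \<open>g\<close>: its
        coefficient absorbs a factor \<open>g\<close>, and cancelling \<open>g\<close> puts
        \<open>v\<close> into \<open>E\<close>.\<close>
      then have "g dvd u" by (rule dvd)
      then obtain w where "u = g * w" by auto
      with ue have "g * v = g * (e + w * f)" by (simp add: algebra_simps)
      then have "v = e + w * f" by (rule cancel)
      with e extends_step show False by blast
    qed
    moreover have "\<phi> {c * v + e | c e. c \<in> K \<and> e \<in> E} = {c * (g * v) + e | c e. c \<in> K \<and> e \<in> \<phi> E}"
    proof (intro equalityI subsetI)
      fix x assume "x \<in> \<phi> {c * v + e | c e. c \<in> K \<and> e \<in> E}"
      then obtain u c e where "c \<in> K" "e \<in> E" "x = u * f + g * (c * v + e)" by (auto simp: \<phi>_def)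
      then have "x = c * (g * v) + (u * f + g * e)" "u * f + g * e \<in> \<phi> E"
        by (simp add: algebra_simps) (use \<open>e \<in> E\<close> in \<open>auto simp: \<phi>_def\<close>)
      with \<open>c \<in> K\<close> show "x \<in> {c * (g * v) + e | c e. c \<in> K \<and> e \<in> \<phi> E}" by blast
    next
      fix x assume "x \<in> {c * (g * v) + e | c e. c \<in> K \<and> e \<in> \<phi> E}"
      then obtain u c e where "c \<in> K" "e \<in> E" "x = c * (g * v) + (u * f + g * e)" by (auto simp: \<phi>_def)
      then have "x = u * f + g * (c * v + e)" "c * v + e \<in> {c * v + e | c e. c \<in> K \<and> e \<in> E}"
        by (auto simp: algebra_simps)
      then show "x \<in> \<phi> {c * v + e | c e. c \<in> K \<and> e \<in> E}" unfolding \<phi>_def by blast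
    qed
    moreover have "\<forall>e\<in>{c * v + e | c e. c \<in> K \<and> e \<in> E}. \<forall>u. e + u * f \<in> {c * v + e | c e. c \<in> K \<and> e \<in> E}"
    proof (intro ballI allI)
      fix x u assume "x \<in> {c * v + e | c e. c \<in> K \<and> e \<in> E}"
      then obtain c e where "c \<in> K" "e \<in> E" "x = c * v + e" by auto
      moreover have "e + u * f \<in> E" using extends_step \<open>e \<in> E\<close> by blast
      ultimately show "x + u * f \<in> {c * v + e | c e. c \<in> K \<and> e \<in> E}"
        using add.assoc by blast
    qed
    ultimately show ?case using extends_step by (simp add: extends.extends_step)
  qed
  have "\<phi> UNIV = pair_ideal f g"
    by (auto simp: \<phi>_def pair_ideal_def mult.commute)
  then have "extends K (pair_ideal f (g * h)) n (pair_ideal f g)"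
    using ext[of n UNIV] assms(4) unfolding colength_def by simp
  then show ?thesis
    using assms(3) extends_trans by (auto simp: colength_def)
qed

section \<open>Dimension of the quotient ring\<close>

lemma carrier_type_algebra [simp]: "carrier ring_of_type_algebra = UNIV"
  and mult_type_algebra [simp]: "x \<otimes>\<^bsub>ring_of_type_algebra\<^esub> y = x * y"
  and add_type_algebra [simp]: "x \<oplus>\<^bsub>ring_of_type_algebra\<^esub> y = x + y"
  and one_type_algebra [simp]: "\<one>\<^bsub>ring_of_type_algebra\<^esub> = 1"
  and zero_type_algebra [simp]: "\<zero>\<^bsub>ring_of_type_algebra\<^esub> = 0"
  by (simp_all add: ring_of_type_algebra_def)

lemma uminus_type_algebra [simp]: "\<ominus>\<^bsub>ring_of_type_algebra\<^esub> x = - (x :: 'a :: comm_ring_1)"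
proof -
  interpret cring "ring_of_type_algebra :: 'a ring" by (rule cring_from_type_algebra)
  show ?thesis by (rule minus_equality) auto
qed

lemma genideal_pair:
  "genideal ring_of_type_algebra {f, g} = pair_ideal f (g :: 'a :: comm_ring_1)"
proof -
  interpret R: cring "ring_of_type_algebra :: 'a ring" by (rule cring_from_type_algebra)
  interpret I: ideal "genideal ring_of_type_algebra {f, g}" "ring_of_type_algebra :: 'a ring"
    by (rule R.genideal_ideal) simp
  show ?thesis
  proof
    have "ideal (pair_ideal f g) (ring_of_type_algebra :: 'a ring)"
    proof (rule idealI)
      show "ring (ring_of_type_algebra :: 'a ring)" by (rule R.ring_axioms)
      have add: "x + y \<in> pair_ideal f g" if "x \<in> pair_ideal f g" "y \<in> pair_ideal f g" for x y
      proof -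
        from that obtain a b c d where "x = a * f + b * g" "y = c * f + d * g"
          by (auto simp: pair_ideal_iff)
        then have "x + y = (a + c) * f + (b + d) * g" by (simp add: algebra_simps)
        then show ?thesis by (auto simp: pair_ideal_iff)
      qed
      have mul: "a * x \<in> pair_ideal f g" if "x \<in> pair_ideal f g" for a x
      proof -
        from that obtain b c where "x = b * f + c * g" by (auto simp: pair_ideal_iff)
        then have "a * x = (a * b) * f + (a * c) * g" by (simp add: algebra_simps)
        then show ?thesis by (auto simp: pair_ideal_iff)
      qed
      show "subgroup (pair_ideal f g) (add_monoid ring_of_type_algebra)"
      proof (rule R.add.subgroupI)
        show "pair_ideal f g \<noteq> {}" by (auto simp: pair_ideal_def)
        show "\<ominus>\<^bsub>ring_of_type_algebra\<^esub> a \<in> pair_ideal f g" if "a \<in> pair_ideal f g" for a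
          using mul[OF that, of "-1"] by simp
      qed (use add in auto)
      show "x \<otimes>\<^bsub>ring_of_type_algebra\<^esub> a \<in> pair_ideal f g"
           "a \<otimes>\<^bsub>ring_of_type_algebra\<^esub> x \<in> pair_ideal f g" if "a \<in> pair_ideal f g" for a x
        using mul[OF that, of x] by (simp_all add: mult.commute)
    qed
    moreover have "f = 1 * f + 0 * g" "g = 0 * f + 1 * g" by simp_all
    then have "f \<in> pair_ideal f g" "g \<in> pair_ideal f g" unfolding pair_ideal_iff by blast+
    then have "{f, g} \<subseteq> pair_ideal f g" by simp
    ultimately show "genideal ring_of_type_algebra {f, g} \<subseteq> pair_ideal f g"
      by (rule R.genideal_minimal)
    have "{f, g} \<subseteq> genideal ring_of_type_algebra {f, g}"
      by (rule R.genideal_self) simp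
    then have "u * f + v * g \<in> genideal ring_of_type_algebra {f, g}" for u v
      using I.I_l_closed[of f u] I.I_l_closed[of g v] I.a_closed by simp
    then show "pair_ideal f g \<subseteq> genideal ring_of_type_algebra {f, g}"
      by (auto simp: pair_ideal_def)
  qed
qed

text \<open>Passing to cosets turns each step of the chain into a line extension in the quotient; it
  stays proper because every member of the chain is a union of cosets of \<open>I\<close>.\<close>

lemma dimension_quot_of_extends:
  fixes I :: "'a::comm_ring_1 set"
  defines "R \<equiv> ring_of_type_algebra :: 'a ring"
  assumes "ideal I R" "extends K I n E"
  shows "ring.dimension (R Quot I) n ((\<lambda>c. I +>\<^bsub>R\<^esub> c) ` K) ((\<lambda>c. I +>\<^bsub>R\<^esub> c) ` E)"
proof -
  interpret R: cring R unfolding R_def by (rule cring_from_type_algebra)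
  interpret I: ideal I R by (rule assms)
  interpret h: ring_hom_ring R "R Quot I" "\<lambda>c. I +>\<^bsub>R\<^esub> c" by (rule I.rcos_ring_hom_ring)
  have coset: "x - y \<in> I" if "I +>\<^bsub>R\<^esub> x = I +>\<^bsub>R\<^esub> y" for x y
  proof -
    have "0 + x \<in> I +>\<^bsub>R\<^esub> x"
      using I.zero_closed unfolding a_r_coset_def' R_def by fastforce
    with that have "x \<in> I +>\<^bsub>R\<^esub> y" by simp
    then show ?thesis unfolding a_r_coset_def' R_def by auto
  qed
  \<comment> \<open>The second conjunct says that \<open>E\<close> is a union of cosets; it lifts
    membership in the image back to \<open>E\<close>.\<close>
  have "ring.dimension (R Quot I) n ((\<lambda>c. I +>\<^bsub>R\<^esub> c) ` K) ((\<lambda>c. I +>\<^bsub>R\<^esub> c) ` E)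
     \<and> (\<forall>e\<in>E. \<forall>i\<in>I. i + e \<in> E)"
    using assms(3)
  proof (induction rule: extends.induct)
    case extends_refl
    have "i + j \<in> I" if "i \<in> I" "j \<in> I" for i j
      using I.a_closed[OF that] by (simp add: R_def)
    moreover have "0 \<in> I" using I.zero_closed by (simp add: R_def)
    then have "(\<lambda>c. I +>\<^bsub>R\<^esub> c) ` I = {\<zero>\<^bsub>R Quot I\<^esub>}"
    proof -
      have "(\<lambda>c. I +>\<^bsub>R\<^esub> c) ` I = (\<lambda>c. I) ` I" by (intro image_cong refl I.a_rcos_const)
      also have "\<dots> = {I}" by (rule image_constant[OF \<open>0 \<in> I\<close>])
      finally show ?thesis unfolding FactRing_def ring.select_convs .
    qed
    ultimately show ?case by (simp add: h.S.dimension.zero_dim)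
  next
    case (extends_step n E v)
    have "I +>\<^bsub>R\<^esub> v \<notin> (\<lambda>c. I +>\<^bsub>R\<^esub> c) ` E"
    proof
      assume "I +>\<^bsub>R\<^esub> v \<in> (\<lambda>c. I +>\<^bsub>R\<^esub> c) ` E"
      then obtain e where "e \<in> E" "v - e \<in> I" by (auto dest: coset)
      then have "(v - e) + e \<in> E" using extends_step.IH by blast
      then show False using extends_step.hyps by simp
    qed
    moreover have "I +>\<^bsub>R\<^esub> v \<in> carrier (R Quot I)" by (rule h.hom_closed) (simp add: R_def)
    ultimately have dim: "h.S.dimension (Suc n) ((\<lambda>c. I +>\<^bsub>R\<^esub> c) ` K)
       (h.S.line_extension ((\<lambda>c. I +>\<^bsub>R\<^esub> c) ` K) (I +>\<^bsub>R\<^esub> v) ((\<lambda>c. I +>\<^bsub>R\<^esub> c) ` E))"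
      using extends_step.IH by (intro h.S.dimension.Suc_dim) auto
    have "I +>\<^bsub>R\<^esub> (c * v + e) = (I +>\<^bsub>R\<^esub> c) \<otimes>\<^bsub>R Quot I\<^esub> (I +>\<^bsub>R\<^esub> v) \<oplus>\<^bsub>R Quot I\<^esub> (I +>\<^bsub>R\<^esub> e)" for c e
      using h.hom_mult[of c v] h.hom_add[of "c * v" e] by (simp add: R_def)
    then have line: "h.S.line_extension ((\<lambda>c. I +>\<^bsub>R\<^esub> c) ` K) (I +>\<^bsub>R\<^esub> v) ((\<lambda>c. I +>\<^bsub>R\<^esub> c) ` E)
       = (\<lambda>c. I +>\<^bsub>R\<^esub> c) ` {c * v + e | c e. c \<in> K \<and> e \<in> E}"
      unfolding h.S.line_extension_def set_add_defs r_coset_def by (auto simp: image_def) blast+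
    have "i + x \<in> {c * v + e | c e. c \<in> K \<and> e \<in> E}"
      if "x \<in> {c * v + e | c e. c \<in> K \<and> e \<in> E}" "i \<in> I" for x i
    proof -
      from that obtain c e where "c \<in> K" "e \<in> E" "x = c * v + e" by auto
      then have "c \<in> K" "i + e \<in> E" "i + x = c * v + (i + e)"
        using extends_step.IH that(2) by (auto simp: algebra_simps)
      then show ?thesis by blast
    qed
    with dim show ?case unfolding line by blast
  qed
  then show ?thesis by blast
qed


section \<open>Division by a coordinate\<close>

text \<open>The differentiability in \<open>holomorphic_at_0\<close> at a single point, which lets
  points on and off an axis be treated separately.\<close>

definition cdiff :: "(complex \<times> complex \<Rightarrow> complex) \<Rightarrow> complex \<times> complex \<Rightarrow> bool" where
  "cdiff F p \<longleftrightarrow> (\<exists>a b. (F has_derivative (\<lambda>(u, v). a * u + b * v)) (at p))"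

lemma holomorphic_at_0_iff_cdiff: "holomorphic_at_0 F \<longleftrightarrow> (\<forall>\<^sub>F p in nhds (0, 0). cdiff F p)"
  by (simp add: holomorphic_at_0_def cdiff_def)

lemma cdiff_add:
  assumes "cdiff F p" "cdiff G p"
  shows "cdiff (\<lambda>p. F p + G p) p"
proof -
  from assms obtain a b c d where F: "(F has_derivative (\<lambda>(u, v). a * u + b * v)) (at p)"
    and G: "(G has_derivative (\<lambda>(u, v). c * u + d * v)) (at p)" unfolding cdiff_def by blast
  show ?thesis unfolding cdiff_def
    by (rule exI[of _ "a + c"], rule exI[of _ "b + d"], rule has_derivative_eq_rhs,
        rule has_derivative_add[OF F G]) (auto simp: fun_eq_iff algebra_simps)
qed

lemma cdiff_mult:
  assumes "cdiff F p" "cdiff G p"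
  shows "cdiff (\<lambda>p. F p * G p) p"
proof -
  from assms obtain a b c d where F: "(F has_derivative (\<lambda>(u, v). a * u + b * v)) (at p)"
    and G: "(G has_derivative (\<lambda>(u, v). c * u + d * v)) (at p)" unfolding cdiff_def by blast
  show ?thesis unfolding cdiff_def
    by (rule exI[of _ "F p * c + a * G p"], rule exI[of _ "F p * d + b * G p"],
        rule has_derivative_eq_rhs, rule has_derivative_mult[OF F G])
       (auto simp: fun_eq_iff algebra_simps)
qed

text \<open>The chain rule; the linear maps include the coordinate swap and the projections to the
  axes.\<close>

lemma cdiff_compose_linear:
  assumes "cdiff F (a * fst p + b * snd p, c * fst p + d * snd p)"
  shows "cdiff (\<lambda>p. F (a * fst p + b * snd p, c * fst p + d * snd p)) p"
proof -
  from assms obtain s t where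
    F: "(F has_derivative (\<lambda>(u, v). s * u + t * v)) (at (a * fst p + b * snd p, c * fst p + d * snd p))"
    unfolding cdiff_def by blast
  have L: "((\<lambda>p. (a * fst p + b * snd p, c * fst p + d * snd p)) has_derivative
      (\<lambda>p. (a * fst p + b * snd p, c * fst p + d * snd p))) (at p)"
    by (auto intro!: derivative_eq_intros)
  show ?thesis unfolding cdiff_def
    by (rule exI[of _ "s * a + t * c"], rule exI[of _ "s * b + t * d"],
        rule has_derivative_eq_rhs, rule has_derivative_compose[OF L F])
       (auto simp: fun_eq_iff algebra_simps)
qed

lemma cdiff_compose_outer:
  assumes "g field_differentiable (at (a * fst p + b * snd p))"
  shows "cdiff (\<lambda>p. g (a * fst p + b * snd p)) p"
proof -
  from assms obtain c where "(g has_field_derivative c) (at (a * fst p + b * snd p))"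
    unfolding field_differentiable_def by blast
  then have g: "(g has_derivative (*) c) (at (a * fst p + b * snd p))"
    by (simp add: has_field_derivative_def)
  have L: "((\<lambda>p. a * fst p + b * snd p) has_derivative (\<lambda>p. a * fst p + b * snd p)) (at p)"
    by (auto intro!: derivative_eq_intros)
  show ?thesis unfolding cdiff_def
    by (rule exI[of _ "c * a"], rule exI[of _ "c * b"],
        rule has_derivative_eq_rhs, rule has_derivative_compose[OF L g])
       (auto simp: fun_eq_iff algebra_simps)
qed

lemmas cdiff_fst = cdiff_compose_outer[where a = 1 and b = 0, simplified]
lemmas cdiff_snd = cdiff_compose_outer[where a = 0 and b = 1, simplified]

lemma cdiff_cong:
  assumes "cdiff F p" "\<forall>\<^sub>F q in nhds p. F q = G q"
  shows "cdiff G p"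
proof -
  have "F p = G p" using assms(2) by (rule eventually_nhds_x_imp_x)
  moreover have "\<forall>\<^sub>F q in at p. F q = G q"
    using assms(2) by (simp add: eventually_at_filter eventually_mono)
  ultimately show ?thesis
    using assms(1) has_derivative_transform_eventually[of F _ p UNIV G] unfolding cdiff_def by auto
qed

lemma cdiff_slices:
  assumes "cdiff F (y, z)"
  shows "(\<lambda>y. F (y, z)) field_differentiable (at y)" "(\<lambda>z. F (y, z)) field_differentiable (at z)"
proof -
  from assms obtain a b where F: "(F has_derivative (\<lambda>(u, v). a * u + b * v)) (at (y, z))"
    unfolding cdiff_def by blast
  have "((\<lambda>y. (y, z)) has_derivative (\<lambda>y. (y, 0))) (at y)"
    "((\<lambda>z. (y, z)) has_derivative (\<lambda>z. (0, z))) (at z)"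
    by (auto intro!: derivative_eq_intros)
  from this[THEN has_derivative_compose, OF F]
  show "(\<lambda>y. F (y, z)) field_differentiable (at y)" "(\<lambda>z. F (y, z)) field_differentiable (at z)"
    unfolding field_differentiable_def has_field_derivative_def by (auto simp: mult_commute_abs)
qed

text \<open>The singularity at \<open>0\<close> is removable. Where \<open>norm y\<close> is at
  least \<open>r / 2\<close>, the numerator is at most \<open>2 * M\<close> in norm, which gives the
  bound; the maximum modulus principle carries it to the inner disc.\<close>

lemma holomorphic_quotient_bound:
  assumes f: "f holomorphic_on ball 0 r" and M: "\<And>y. y \<in> ball 0 r \<Longrightarrow> norm (f y) \<le> M"
    and y: "y \<in> ball (0::complex) r"
  shows "norm (if y = 0 then deriv f 0 else (f y - f 0) / y) \<le> 4 * M / r"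
proof -
  define g where "g = (\<lambda>y. if y = 0 then deriv f 0 else (f y - f 0) / y)"
  from y have r: "r > 0" by (auto dest: le_less_trans[OF norm_ge_zero])
  have g: "g holomorphic_on ball 0 r"
    using pole_lemma_open[OF f open_ball, of 0] unfolding g_def diff_0_right .
  have far: "norm (g w) \<le> 4 * M / r" if w: "w \<in> ball 0 r" "norm w \<ge> r / 2" for w
  proof -
    have "norm (f w - f 0) \<le> M + M"
      using M[OF w(1)] M[of 0] r by (intro order.trans[OF norm_triangle_ineq4] add_mono) auto
    moreover have "M \<ge> 0" using M[OF w(1)] norm_ge_zero order.trans by blast
    moreover have "w \<noteq> 0" using w(2) r by auto
    ultimately have "norm (f w - f 0) / norm w \<le> (M + M) / (r / 2)"
      using w r by (intro frac_le) auto
    with \<open>w \<noteq> 0\<close> show ?thesis by (simp add: g_def norm_divide)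
  qed
  have "norm (g y) \<le> 4 * M / r"
  proof (cases "norm y \<ge> r / 2")
    case True
    with y far show ?thesis by blast
  next
    case False
    have sub: "cball 0 (r / 2) \<subseteq> ball (0::complex) r" using r by auto
    show ?thesis
    proof (rule maximum_modulus_frontier[of g "cball 0 (r / 2)"])
      show "g holomorphic_on interior (cball 0 (r / 2))"
        using g sub holomorphic_on_subset interior_subset by blast
      show "continuous_on (closure (cball 0 (r / 2))) g"
        using holomorphic_on_imp_continuous_on[OF holomorphic_on_subset[OF g sub]] by simp
      show "norm (g w) \<le> 4 * M / r" if "w \<in> frontier (cball 0 (r / 2))" for w
        using that r by (intro far) auto
    qed (use False in auto)
  qed
  then show ?thesis by (simp add: g_def)
qed

text \<open>Separate holomorphy with a bound on a polydisc is a condition that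
  \<open>y_quotient\<close> preserves with a larger constant, so division by \<open>y\<close> can be
  iterated before joint differentiability is known.\<close>

definition sep_bounded :: "real \<Rightarrow> real \<Rightarrow> (complex \<times> complex \<Rightarrow> complex) \<Rightarrow> bool" where
  "sep_bounded r M F \<longleftrightarrow>
     (\<forall>z\<in>ball 0 r. (\<lambda>y. F (y, z)) holomorphic_on ball 0 r) \<and>
     (\<forall>y\<in>ball 0 r. (\<lambda>z. F (y, z)) holomorphic_on ball 0 r) \<and>
     (\<forall>y\<in>ball 0 r. \<forall>z\<in>ball 0 r. norm (F (y, z)) \<le> M)"

text \<open>The divided difference of \<open>F\<close> in \<open>y\<close> based at the axis
  \<open>y = 0\<close>, with the removable singularity filled by the derivative.\<close>

definition y_quotient :: "(complex \<times> complex \<Rightarrow> complex) \<Rightarrow> complex \<times> complex \<Rightarrow> complex" where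
  "y_quotient F = (\<lambda>(y, z). if y = 0 then deriv (\<lambda>y. F (y, z)) 0 else (F (y, z) - F (0, z)) / y)"

lemma y_quotient_eq: "F (y, z) = F (0, z) + y * y_quotient F (y, z)"
  by (simp add: y_quotient_def)

text \<open>The delicate point is holomorphy in \<open>z\<close> on \<open>y = 0\<close>. There the
  quotient is a uniform limit of its slices at nonzero \<open>y\<close>.\<close>

lemma sep_bounded_y_quotient:
  assumes F: "sep_bounded r M F" and r: "r > 0"
  shows "sep_bounded r (4 * M / r) (y_quotient F)"
  unfolding sep_bounded_def
proof (intro conjI ballI)
  define Q where "Q = y_quotient F"
  have Fy: "(\<lambda>y. F (y, z)) holomorphic_on ball 0 r" if "z \<in> ball 0 r" for z
    using F that by (auto simp: sep_bounded_def)
  have Fz: "(\<lambda>z. F (y, z)) holomorphic_on ball 0 r" if "y \<in> ball 0 r" for y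
    using F that by (auto simp: sep_bounded_def)
  have Fb: "norm (F (y, z)) \<le> M" if "y \<in> ball 0 r" "z \<in> ball 0 r" for y z
    using F that by (auto simp: sep_bounded_def)
  have Qb: "norm (Q (y, z)) \<le> 4 * M / r" if "y \<in> ball 0 r" "z \<in> ball 0 r" for y z
    using holomorphic_quotient_bound[OF Fy[OF that(2)] Fb[OF _ that(2)] that(1)]
    by (simp add: Q_def y_quotient_def)
  then show "norm (y_quotient F (y, z)) \<le> 4 * M / r" if "y \<in> ball 0 r" "z \<in> ball 0 r" for y z
    using that by (simp add: Q_def)
  have Qy: "(\<lambda>y. Q (y, z)) holomorphic_on ball 0 r" if "z \<in> ball 0 r" for z
    using pole_lemma_open[OF Fy[OF that] open_ball, of 0]
    unfolding Q_def y_quotient_def diff_0_right by simp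
  then show "(\<lambda>y. y_quotient F (y, z)) holomorphic_on ball 0 r" if "z \<in> ball 0 r" for z
    using that by (simp add: Q_def)
  have Qz: "(\<lambda>z. Q (y, z)) holomorphic_on ball 0 r" if "y \<in> ball 0 r" "y \<noteq> 0" for y
    using that Fz[OF that(1)] Fz[of 0] r unfolding Q_def y_quotient_def
    by (auto intro!: holomorphic_intros)
  \<comment> \<open>The bound for divided differences, applied to \<open>Q\<close> in place of
    \<open>F\<close>, gives an estimate linear in \<open>norm y\<close> and uniform in
    \<open>z\<close>.\<close>
  have Qdiff: "norm (Q (y, z) - Q (0, z)) \<le> 4 * (4 * M / r) / r * norm y"
    if "y \<in> ball 0 r" "z \<in> ball 0 r" for y z
  proof (cases "y = 0")
    case False
    with holomorphic_quotient_bound[OF Qy[OF that(2)] Qb[OF _ that(2)] that(1)]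
    have "norm (Q (y, z) - Q (0, z)) / norm y \<le> 4 * (4 * M / r) / r" by (simp add: norm_divide)
    with False show ?thesis by (simp add: pos_divide_le_eq)
  qed simp
  \<comment> \<open>Nonzero points tending to \<open>0\<close>; the summand \<open>2\<close> keeps
    \<open>h 0\<close> strictly inside the ball.\<close>
  define h :: "nat \<Rightarrow> complex" where "h n = of_real (r / (real n + 2))" for n
  have h: "h n \<in> ball 0 r" "h n \<noteq> 0" for n
  proof -
    have "norm (h n) = r / (real n + 2)" "r / (real n + 2) < r"
      using r unfolding h_def norm_of_real by (simp_all add: field_simps add_pos_nonneg)
    then show "h n \<in> ball 0 r" "h n \<noteq> 0" using r by auto
  qed
  have "(\<lambda>n. r / (real n + 2)) \<longlonglongrightarrow> 0" by real_asymp
  from tendsto_of_real[OF this, where ?'a = complex] have h0: "h \<longlonglongrightarrow> 0"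
    unfolding h_def[abs_def] of_real_0 .
  have "(\<lambda>z. Q (0, z)) holomorphic_on ball 0 r"
  proof (rule holomorphic_uniform_sequence[where f = "\<lambda>n z. Q (h n, z)"])
    show "(\<lambda>z. Q (h n, z)) holomorphic_on ball 0 r" for n using Qz h by blast
    fix x :: complex assume "x \<in> ball 0 r"
    then obtain d where d: "d > 0" "cball x d \<subseteq> ball 0 r"
      using open_contains_cball open_ball by blast
    have "uniform_limit (cball x d) (\<lambda>n z. Q (h n, z)) (\<lambda>z. Q (0, z)) sequentially"
    proof (rule uniform_limitI)
      fix e :: real assume "e > 0"
      have "(\<lambda>n. 4 * (4 * M / r) / r * norm (h n)) \<longlonglongrightarrow> 4 * (4 * M / r) / r * norm (0::complex)"
        by (intro tendsto_intros h0)
      then have "\<forall>\<^sub>F n in sequentially. 4 * (4 * M / r) / r * norm (h n) < e"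
        using \<open>e > 0\<close> by (intro order_tendstoD(2)) auto
      then show "\<forall>\<^sub>F n in sequentially. \<forall>z\<in>cball x d. dist (Q (h n, z)) (Q (0, z)) < e"
      proof eventually_elim
        case (elim n)
        show ?case
        proof
          fix z assume "z \<in> cball x d"
          with d have "z \<in> ball 0 r" by blast
          from Qdiff[OF h(1) this] elim show "dist (Q (h n, z)) (Q (0, z)) < e"
            unfolding dist_norm by (rule le_less_trans)
        qed
      qed
    qed
    with d show "\<exists>d>0. cball x d \<subseteq> ball 0 r \<and>
      uniform_limit (cball x d) (\<lambda>n z. Q (h n, z)) (\<lambda>z. Q (0, z)) sequentially" by blast
  qed auto
  with Qz show "(\<lambda>z. y_quotient F (y, z)) holomorphic_on ball 0 r" if "y \<in> ball 0 r" for y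
    using that by (cases "y = 0") (simp_all add: Q_def)
qed

text \<open>Dividing the quadratic bound by \<open>norm (q - p)\<close> leaves a quantity tending to
  \<open>0\<close>, so the derivative at \<open>p\<close> is zero.\<close>

lemma cdiff_quadratic:
  assumes "\<forall>\<^sub>F q in nhds p. norm (F q) \<le> C * norm (q - p) ^ 2"
  shows "cdiff F p"
proof -
  have Fp: "F p = 0" using eventually_nhds_x_imp_x[OF assms] by simp
  have "((\<lambda>q. C * norm (q - p)) \<longlongrightarrow> C * norm (p - p)) (at p)" by (intro tendsto_intros)
  then have lim: "((\<lambda>q. C * norm (q - p)) \<longlongrightarrow> 0) (at p)" by simp
  have "\<forall>\<^sub>F q in at p. norm (F q) \<le> C * norm (q - p) ^ 2"
    using assms by (simp add: eventually_at_filter eventually_mono)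
  moreover have "\<forall>\<^sub>F q in at p. q \<noteq> p" by (simp add: eventually_at_filter)
  ultimately have "\<forall>\<^sub>F q in at p. norm (norm (F q - F p - 0) / norm (q - p)) \<le> C * norm (q - p)"
    by eventually_elim (simp add: Fp pos_divide_le_eq power2_eq_square mult.assoc)
  then have "((\<lambda>q. norm (F q - F p - 0) / norm (q - p)) \<longlongrightarrow> 0) (at p)"
    using lim by (rule Lim_null_comparison)
  then have "(F has_derivative (\<lambda>q. 0)) (at p)"
    by (simp add: has_derivative_iff_norm)
  then show ?thesis
    unfolding cdiff_def by (intro exI[of _ 0]) (simp add: case_prod_unfold)
qed

text \<open>Two divisions by \<open>y\<close> expand \<open>F\<close> as \<open>D(z) + y E(z) + y\<^sup>2 G(y, z)\<close> with \<open>G\<close> bounded.\<close>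

lemma cdiff_sep_bounded:
  assumes F: "sep_bounded r M F" and z: "z \<in> ball 0 r"
  shows "cdiff F (0, z)"
proof -
  from z have r: "r > 0" by (auto dest: le_less_trans[OF norm_ge_zero])
  define G where "G = y_quotient F"
  define H where "H = y_quotient G"
  have G: "sep_bounded r (4 * M / r) G" unfolding G_def by (rule sep_bounded_y_quotient[OF F r])
  have H: "sep_bounded r (4 * (4 * M / r) / r) H" unfolding H_def by (rule sep_bounded_y_quotient[OF G r])
  have diff: "(\<lambda>z. K (0, z)) field_differentiable (at z)" if "sep_bounded r N K" for N K
  proof -
    have "(\<lambda>z. K (0, z)) holomorphic_on ball 0 r" using that r by (simp add: sep_bounded_def)
    then show ?thesis using z by (simp add: holomorphic_on_imp_differentiable_at)
  qed
  have "\<forall>\<^sub>F p in nhds ((0::complex), z). p \<in> ball 0 r \<times> ball 0 r"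
    using z r by (intro eventually_nhds_in_open) (auto intro: open_Times)
  \<comment> \<open>The bound on \<open>H\<close> makes the remainder quadratic in the distance to
    \<open>(0, z)\<close>.\<close>
  then have "\<forall>\<^sub>F p in nhds (0, z). norm (fst p ^ 2 * H p) \<le> 4 * (4 * M / r) / r * norm (p - (0, z)) ^ 2"
  proof eventually_elim
    case (elim p)
    obtain y w where p: "p = (y, w)" by (cases p)
    have Hb: "norm (H p) \<le> 4 * (4 * M / r) / r" using H elim by (auto simp: p sep_bounded_def)
    moreover have "norm y \<le> norm (p - (0, z))" by (simp add: p norm_Pair)
    then have "norm y ^ 2 \<le> norm (p - (0, z)) ^ 2" by (intro power_mono) auto
    ultimately have "norm (H p) * norm y ^ 2 \<le> 4 * (4 * M / r) / r * norm (p - (0, z)) ^ 2"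
      using order.trans[OF norm_ge_zero Hb] by (intro mult_mono) auto
    then show ?case by (simp add: p norm_mult norm_power mult.commute)
  qed
  then have "cdiff (\<lambda>p. fst p ^ 2 * H p) (0, z)" by (rule cdiff_quadratic)
  moreover have "cdiff (\<lambda>p. F (0, snd p)) (0, z)" "cdiff (\<lambda>p. fst p * G (0, snd p)) (0, z)"
    using diff[OF F] diff[OF G] by (auto intro!: cdiff_snd cdiff_mult cdiff_fst[of "\<lambda>y. y"])
  ultimately have "cdiff (\<lambda>p. F (0, snd p) + (fst p * G (0, snd p) + fst p ^ 2 * H p)) (0, z)"
    by (intro cdiff_add)
  moreover have "F (0, snd p) + (fst p * G (0, snd p) + fst p ^ 2 * H p) = F p" for p
  proof (cases p)
    case (Pair y w)
    have "F (y, w) = F (0, w) + y * G (y, w)" unfolding G_def by (rule y_quotient_eq)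
    moreover have "G (y, w) = G (0, w) + y * H (y, w)" unfolding H_def by (rule y_quotient_eq)
    ultimately show ?thesis using Pair by (simp add: algebra_simps power2_eq_square)
  qed
  ultimately show ?thesis by simp
qed

text \<open>Continuity at the origin bounds \<open>F\<close> nearby. The property \<open>P\<close>
  lets a further local condition hold on the same polydisc.\<close>

lemma holomorphic_at_0_polydisc:
  assumes "holomorphic_at_0 F" "\<forall>\<^sub>F p in nhds (0, 0). P p"
  obtains r M where "r > 0" "sep_bounded r M F"
    "\<forall>y\<in>ball 0 r. \<forall>z\<in>ball 0 r. cdiff F (y, z) \<and> P (y, z)"
proof -
  have F: "\<forall>\<^sub>F p in nhds (0, 0). cdiff F p" using assms(1) by (simp add: holomorphic_at_0_iff_cdiff)
  then have "cdiff F (0, 0)" by (rule eventually_nhds_x_imp_x)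
  then have "isCont F (0, 0)" unfolding cdiff_def using has_derivative_continuous by blast
  then have "\<forall>\<^sub>F p in nhds (0, 0). dist (F p) (F (0, 0)) < 1"
    using tendstoD[of F "F (0, 0)" "nhds (0, 0)" 1] by (simp add: isCont_def tendsto_at_iff_tendsto_nhds)
  with F assms(2) have "\<forall>\<^sub>F p in nhds (0, 0). cdiff F p \<and> P p \<and> dist (F p) (F (0, 0)) < 1"
    by eventually_elim simp
  then obtain d where d: "d > 0"
    "\<And>p. dist p (0, 0) < d \<Longrightarrow> cdiff F p \<and> P p \<and> dist (F p) (F (0, 0)) < 1"
    unfolding eventually_nhds_metric by auto
  \<comment> \<open>Radius \<open>d / 2\<close> in each coordinate suffices, as the norm of a pair
    is at most the sum of the norms.\<close>
  have near: "cdiff F (y, z) \<and> P (y, z) \<and> dist (F (y, z)) (F (0, 0)) < 1"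
    if "y \<in> ball 0 (d / 2)" "z \<in> ball 0 (d / 2)" for y z
  proof -
    have "norm (y, z) \<le> norm y + norm z" by (rule norm_Pair_le)
    also have "\<dots> < d" using that by auto
    finally show ?thesis using d(2)[of "(y, z)"] by (simp add: dist_norm)
  qed
  have "norm (F (y, z)) \<le> norm (F (0, 0)) + 1" if "y \<in> ball 0 (d / 2)" "z \<in> ball 0 (d / 2)" for y z
    using near[OF that] norm_triangle_ineq2[of "F (y, z)" "F (0, 0)"] by (simp add: dist_norm)
  then have "sep_bounded (d / 2) (norm (F (0, 0)) + 1) F"
    unfolding sep_bounded_def holomorphic_on_def
    using near cdiff_slices[of F, THEN field_differentiable_at_within] by blast
  moreover have "\<forall>y\<in>ball 0 (d / 2). \<forall>z\<in>ball 0 (d / 2). cdiff F (y, z) \<and> P (y, z)"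
    using near by blast
  ultimately show ?thesis using that[of "d / 2"] d(1) by simp
qed

text \<open>The divided difference of \<open>F\<close> is the quotient. Off the axis it is
  \<open>F\<close> times the reciprocal of \<open>y\<close>; on the axis its differentiability is
  \<open>cdiff_sep_bounded\<close>.\<close>

lemma holomorphic_at_0_divide_fst:
  assumes F: "holomorphic_at_0 F"
    and "\<forall>\<^sub>F p in nhds (0::complex, 0::complex). F (0, snd p) = 0"
  obtains G where "holomorphic_at_0 G" "\<forall>\<^sub>F p in nhds (0, 0). F p = fst p * G p"
proof -
  obtain r M where r: "r > 0" "sep_bounded r M F"
    and near': "\<forall>y\<in>ball 0 r. \<forall>z\<in>ball 0 r. cdiff F (y, z) \<and> F (0, snd (y, z)) = 0"
    by (rule holomorphic_at_0_polydisc[OF assms])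
  have near: "cdiff F (y, z) \<and> F (0, z) = 0" if "y \<in> ball 0 r" "z \<in> ball 0 r" for y z
    using near' that by auto
  define G where "G = y_quotient F"
  have FG: "F p = fst p * G p" if "p \<in> ball 0 r \<times> ball 0 r" for p
    using that near y_quotient_eq[of F "fst p" "snd p"] by (cases p) (auto simp: G_def)
  have G: "cdiff G (y, z)" if "y \<in> ball 0 r" "z \<in> ball 0 r" for y z
  proof (cases "y = 0")
    case True
    then show ?thesis
      using cdiff_sep_bounded[OF sep_bounded_y_quotient[OF r(2,1)] that(2)] by (simp add: G_def)
  next
    case False
    have "inverse field_differentiable (at (fst (y, z)))"
      using False by (simp add: field_differentiable_inverse)
    then have "cdiff (\<lambda>p. F p * inverse (fst p)) (y, z)"
      using near[OF that] by (intro cdiff_mult cdiff_fst) auto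
    moreover have "\<forall>\<^sub>F p in nhds (y, z). p \<in> (ball 0 r - {0}) \<times> ball 0 r"
      using False that by (intro eventually_nhds_in_open) (auto intro!: open_Times)
    then have "\<forall>\<^sub>F p in nhds (y, z). F p * inverse (fst p) = G p"
      by eventually_elim (auto simp: FG field_simps split: if_splits)
    ultimately show ?thesis by (rule cdiff_cong)
  qed
  have ev: "\<forall>\<^sub>F p in nhds ((0::complex), (0::complex)). p \<in> ball 0 r \<times> ball 0 r"
    using r by (intro eventually_nhds_in_open) (auto intro!: open_Times)
  show ?thesis
  proof
    show "holomorphic_at_0 G"
      unfolding holomorphic_at_0_iff_cdiff using ev by eventually_elim (use G in auto)
    show "\<forall>\<^sub>F p in nhds (0, 0). F p = fst p * G p"
      using ev by eventually_elim (use FG in auto)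
  qed
qed

text \<open>Away from the axis \<open>y\<close> cancels pointwise; continuity in \<open>y\<close>
  extends the vanishing to the axis.\<close>

lemma holomorphic_at_0_fst_cancel:
  assumes "holomorphic_at_0 F" "\<forall>\<^sub>F p in nhds (0, 0). fst p * F p = 0"
  shows "\<forall>\<^sub>F p in nhds (0, 0). F p = 0"
proof -
  obtain r M where r: "r > 0" "sep_bounded r M F"
    and near': "\<forall>y\<in>ball 0 r. \<forall>z\<in>ball 0 r. cdiff F (y, z) \<and> fst (y, z) * F (y, z) = 0"
    by (rule holomorphic_at_0_polydisc[OF assms])
  have near: "cdiff F (y, z) \<and> y * F (y, z) = 0" if "y \<in> ball 0 r" "z \<in> ball 0 r" for y z
    using near' that by auto
  have "F (y, z) = 0" if "y \<in> ball 0 r" "z \<in> ball 0 r" for y z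
  proof (cases "y = 0")
    case True
    have "isCont (\<lambda>y. F (y, z)) 0"
      using near[of 0 z] that r
      by (auto intro: field_differentiable_imp_continuous_at dest: cdiff_slices)
    then have "((\<lambda>y. F (y, z)) \<longlongrightarrow> F (0, z)) (at 0)" by (simp add: isCont_def)
    moreover have "\<forall>\<^sub>F y in at 0. F (y, z) = 0"
      unfolding eventually_at using near that r by (auto intro!: exI[of _ r] simp: dist_norm)
    then have "((\<lambda>y. F (y, z)) \<longlongrightarrow> 0) (at 0)" by (rule tendsto_eventually)
    ultimately show ?thesis using True tendsto_unique[of "at (0::complex)"] by auto
  next
    case False
    with near[OF that] show ?thesis by simp
  qed
  moreover have "\<forall>\<^sub>F p in nhds ((0::complex), (0::complex)). p \<in> ball 0 r \<times> ball 0 r"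
    using r by (intro eventually_nhds_in_open) (auto intro!: open_Times)
  ultimately show ?thesis by (auto elim!: eventually_mono)
qed


section \<open>Germs\<close>

lemma eval_yz_eq_sum:
  assumes "finite S" "Poly_Mapping.keys p \<subseteq> S"
  shows "eval_yz p q = (\<Sum>k\<in>S. Poly_Mapping.lookup p k * fst q ^ fst k * snd q ^ snd k)"
  unfolding eval_yz_def case_prod_unfold
  using assms by (auto intro!: sum.mono_neutral_left simp: in_keys_iff)

lemma eval_yz_add: "eval_yz (p + q) x = eval_yz p x + eval_yz q x"
proof -
  let ?S = "Poly_Mapping.keys p \<union> Poly_Mapping.keys q"
  have "finite ?S" "Poly_Mapping.keys (p + q) \<subseteq> ?S" by (simp_all add: Poly_Mapping.keys_add)
  then show ?thesis
    by (simp add: eval_yz_eq_sum[of ?S] lookup_add distrib_right sum.distrib)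
qed

lemma eval_yz_uminus: "eval_yz (- p) x = - eval_yz p x"
  by (simp add: eval_yz_eq_sum[of "Poly_Mapping.keys p"] sum_negf)

lemma eval_yz_single: "eval_yz (Poly_Mapping.single (i, j) c) x = c * fst x ^ i * snd x ^ j"
  by (simp add: eval_yz_eq_sum[of "{(i, j)}"])

section \<open>Linear substitutions, restriction to an axis and value at the origin\<close>

lemma eventually_linear:
  assumes "\<forall>\<^sub>F q in nhds (0::complex, 0::complex). P q"
  shows "\<forall>\<^sub>F p in nhds (0, 0). P (a * fst p + b * snd p, c * fst p + d * snd p)"
proof -
  let ?L = "\<lambda>p::complex \<times> complex. (a * fst p + b * snd p, c * fst p + d * snd p)"
  have "isCont ?L (0, 0)" by (intro continuous_intros)
  then have "(?L \<longlongrightarrow> ?L (0, 0)) (nhds (0, 0))"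
    using tendsto_at_iff_tendsto_nhds[of ?L "(0, 0)"] unfolding isCont_def by blast
  then show ?thesis using assms by (simp add: filterlim_iff)
qed

lemma germ_rel_linear:
  assumes "germ_rel F G"
  shows "germ_rel (\<lambda>p. F (a * fst p + b * snd p, c * fst p + d * snd p))
                  (\<lambda>p. G (a * fst p + b * snd p, c * fst p + d * snd p))"
proof -
  let ?L = "\<lambda>p. (a * fst p + b * snd p, c * fst p + d * snd p)"
  have "holomorphic_at_0 (\<lambda>p. H (?L p))" if "holomorphic_at_0 H" for H
    using eventually_linear[of "cdiff H" a b c d] that unfolding holomorphic_at_0_iff_cdiff
    by (auto elim!: eventually_mono intro: cdiff_compose_linear)
  then show ?thesis
    using assms eventually_linear[of "\<lambda>p. F p = G p" a b c d] by (auto simp: germ_rel_def)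
qed

text \<open>Carries facts about \<open>germ_y\<close> over to \<open>germ_z\<close>.\<close>

lift_definition germ_swap :: "germ \<Rightarrow> germ" is "\<lambda>F p. F (snd p, fst p)"
  using germ_rel_linear[where a = 0 and b = 1 and c = 1 and d = 0] by simp

text \<open>Restriction to \<open>y = 0\<close>, kept as a germ in both variables that is constant
  in \<open>y\<close>, so that it is an endomorphism of the ring of germs.\<close>

lift_definition germ_axis :: "germ \<Rightarrow> germ" is "\<lambda>F p. F (0, snd p)"
  using germ_rel_linear[where a = 0 and b = 0 and c = 0 and d = 1] by simp

lift_definition germ_val :: "germ \<Rightarrow> complex" is "\<lambda>F. F (0, 0)"
  by (auto simp: germ_rel_def dest: eventually_nhds_x_imp_x)

lift_definition germ_y :: germ is fst by (simp add: germ_rel_def holomorphic_at_0_fst)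
lift_definition germ_z :: germ is snd by (simp add: germ_rel_def holomorphic_at_0_snd)

lemma germ_rel_reflI: "holomorphic_at_0 F \<Longrightarrow> germ_rel F F"
  by (simp add: germ_rel_def)

text \<open>Lifting an identity of functions to germs leaves reflexivity goals for
  \<open>germ_rel\<close>; these facts are collected for them in
  \<open>germ_rel_intros\<close>.\<close>

lemma germ_swap_linear: "germ_rel F F \<Longrightarrow> germ_rel (\<lambda>p. F (snd p, fst p)) (\<lambda>p. F (snd p, fst p))"
  and germ_axis_linear: "germ_rel F F \<Longrightarrow> germ_rel (\<lambda>p. F (0, snd p)) (\<lambda>p. F (0, snd p))"
  and germ_axis_swap_axis_linear: "germ_rel F F \<Longrightarrow> germ_rel (\<lambda>p. F (0, fst p)) (\<lambda>p. F (0, fst p))"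
  using germ_rel_linear[of F F 0 1 1 0] germ_rel_linear[of F F 0 0 0 1] germ_rel_linear[of F F 0 0 1 0]
  by simp_all

lemma germ_rel_mult_refl: "germ_rel F F \<Longrightarrow> germ_rel G G \<Longrightarrow> germ_rel (\<lambda>p. F p * G p) (\<lambda>p. F p * G p)"
  and germ_rel_add_refl: "germ_rel F F \<Longrightarrow> germ_rel G G \<Longrightarrow> germ_rel (\<lambda>p. F p + G p) (\<lambda>p. F p + G p)"
  and germ_rel_uminus_refl: "germ_rel F F \<Longrightarrow> germ_rel (\<lambda>p. - F p) (\<lambda>p. - F p)"
  and germ_rel_const_refl: "germ_rel (\<lambda>p. c) (\<lambda>p. c)"
  by (simp_all add: germ_rel_def holomorphic_at_0_mult holomorphic_at_0_add
      holomorphic_at_0_uminus holomorphic_at_0_const)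

lemmas germ_rel_intros = germ_swap_linear germ_axis_linear germ_axis_swap_axis_linear
  germ_rel_mult_refl germ_rel_add_refl germ_rel_uminus_refl germ_rel_const_refl
  germ_rel_reflI[OF holomorphic_at_0_fst] germ_rel_reflI[OF holomorphic_at_0_snd]

lemma germ_swap_swap: "germ_swap (germ_swap F) = F"
  by transfer simp

lemma germ_swap_mult: "germ_swap (F * G) = germ_swap F * germ_swap G"
  by transfer (auto intro!: germ_rel_intros)

lemma germ_swap_add: "germ_swap (F + G) = germ_swap F + germ_swap G"
  by transfer (auto intro!: germ_rel_intros)

lemma germ_swap_const: "germ_swap (germ_const c) = germ_const c"
  by transfer (auto intro!: germ_rel_intros)

lemma germ_swap_y: "germ_swap germ_y = germ_z" and germ_swap_z: "germ_swap germ_z = germ_y"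
  by (transfer; auto intro!: germ_rel_intros)+

lemma germ_axis_axis: "germ_axis (germ_axis F) = germ_axis F"
  by transfer (auto intro!: germ_rel_intros)

lemma germ_axis_mult: "germ_axis (F * G) = germ_axis F * germ_axis G"
  by transfer (auto intro!: germ_rel_intros)

lemma germ_axis_add: "germ_axis (F + G) = germ_axis F + germ_axis G"
  by transfer (auto intro!: germ_rel_intros)

lemma germ_axis_uminus: "germ_axis (- F) = - germ_axis F"
  by transfer (auto intro!: germ_rel_intros)

lemma germ_axis_const: "germ_axis (germ_const c) = germ_const c"
  by transfer (auto intro!: germ_rel_intros)

lemma germ_axis_y: "germ_axis germ_y = 0" and germ_axis_z: "germ_axis germ_z = germ_z"
  by (transfer; auto intro!: germ_rel_intros)+

text \<open>The swap turns the surviving variable into the one set to zero next, so only the value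
  at the origin is left.\<close>

lemma germ_axis_swap_axis: "germ_axis (germ_swap (germ_axis F)) = germ_const (germ_val F)"
  by transfer (auto intro!: germ_rel_intros)

lemma germ_val_simps: "germ_val (F * G) = germ_val F * germ_val G"
  "germ_val (F + G) = germ_val F + germ_val G" "germ_val 1 = 1"
  "germ_val germ_y = 0" "germ_val germ_z = 0"
  by (transfer; simp)+

lemma germ_const_simps: "germ_const 0 = 0" "germ_const 1 = 1"
  "germ_const (a + b) = germ_const a + germ_const b"
  "germ_const (a * b) = germ_const a * germ_const b"
  "germ_const (- a) = - germ_const a"
  by (transfer; auto intro!: germ_rel_intros)+

text \<open>The analytic division result in algebraic form; from here on divisibility by
  \<open>y\<close> is computed with \<open>germ_axis\<close>.\<close>

lemma germ_y_dvd_iff_axis: "germ_y dvd F \<longleftrightarrow> germ_axis F = 0"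
proof
  assume "germ_axis F = 0"
  then have "\<exists>G. F = germ_y * G"
  proof transfer
    fix F assume F: "germ_rel F F" and "germ_rel (\<lambda>p. F (0, snd p)) (\<lambda>p. 0)"
    then obtain G where "holomorphic_at_0 G" "\<forall>\<^sub>F p in nhds (0, 0). F p = fst p * G p"
      using holomorphic_at_0_divide_fst[of F] by (auto simp: germ_rel_def)
    with F show "\<exists>G\<in>{x. germ_rel x x}. germ_rel F (\<lambda>p. fst p * G p)"
      by (intro bexI[of _ G]) (auto simp: germ_rel_def intro: holomorphic_at_0_mult holomorphic_at_0_fst)
  qed
  then show "germ_y dvd F" by auto
qed (auto simp: germ_axis_mult germ_axis_y)

lemma germ_y_cancel_0: "germ_y * F = 0 \<Longrightarrow> F = 0"
  by transfer (auto simp: germ_rel_def holomorphic_at_0_const intro: holomorphic_at_0_fst_cancel)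

text \<open>By continuity \<open>z + c\<close> has no zero near the origin, so its pointwise
  reciprocal is a holomorphic germ.\<close>

lemma germ_z_plus_const_unit:
  assumes "c \<noteq> 0"
  shows "germ_z + germ_const c dvd 1"
proof -
  have "\<exists>G. 1 = (germ_z + germ_const c) * G"
    using assms
  proof transfer
    fix c :: complex assume c: "c \<noteq> 0"
    have "isCont (\<lambda>p::complex \<times> complex. snd p + c) (0, 0)" by (intro continuous_intros)
    then have "((\<lambda>p::complex \<times> complex. snd p + c) \<longlongrightarrow> snd (0::complex, 0::complex) + c) (nhds (0, 0))"
      using tendsto_at_iff_tendsto_nhds[of "\<lambda>p. snd p + c" "(0::complex, 0::complex)"]
      unfolding isCont_def by blast
    then have ev: "\<forall>\<^sub>F p in nhds ((0::complex), (0::complex)). snd p + c \<noteq> 0"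
      using c tendsto_imp_eventually_ne by fastforce
    then have hol: "holomorphic_at_0 (\<lambda>p. inverse (snd p + c))"
      unfolding holomorphic_at_0_iff_cdiff
    proof eventually_elim
      case (elim p)
      then have "(\<lambda>z. inverse (z + c)) field_differentiable (at (snd p))"
        by (intro derivative_intros) auto
      then show ?case by (rule cdiff_snd)
    qed
    have "germ_rel (\<lambda>_. 1) (\<lambda>p. (snd p + c) * inverse (snd p + c))"
      unfolding germ_rel_def using ev hol
      by (auto intro!: holomorphic_at_0_const holomorphic_at_0_mult holomorphic_at_0_add
          holomorphic_at_0_snd elim!: eventually_mono)
    then show "\<exists>G\<in>{x. germ_rel x x}. germ_rel (\<lambda>_. 1) (\<lambda>p. (snd p + c) * G p)"
      using hol by (intro bexI[of _ "\<lambda>p. inverse (snd p + c)"]) (auto simp: germ_rel_def)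
  qed
  then show ?thesis by (metis dvd_triv_left)
qed


section \<open>Intersection numbers of the cubic\<close>

lemma germ_y_cancel: "germ_y * u = germ_y * v \<Longrightarrow> u = v"
  using germ_y_cancel_0[of "u - v"] by (simp add: algebra_simps)

lemma germ_z_cancel: "germ_z * u = germ_z * v \<Longrightarrow> u = v"
  by (metis germ_swap_mult germ_swap_swap germ_swap_z germ_y_cancel)

text \<open>Restriction to \<open>y = 0\<close> fixes \<open>z\<close>, which can then be cancelled,
  so the restriction of \<open>u\<close> vanishes.\<close>

lemma germ_y_dvd_z_mult: "germ_y dvd germ_z * u \<Longrightarrow> germ_y dvd u"
  using germ_z_cancel[of "germ_axis u" 0] by (simp add: germ_y_dvd_iff_axis germ_axis_mult germ_axis_z)

lemma germ_z_dvd_y_mult: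
  assumes "germ_z dvd germ_y * u"
  shows "germ_z dvd u"
proof -
  from assms obtain v where v: "germ_y * u = germ_z * v" by auto
  then have "germ_y dvd v" by (metis dvd_triv_left germ_y_dvd_z_mult)
  then obtain w where "v = germ_y * w" by auto
  with v have "germ_y * u = germ_y * (germ_z * w)" by (simp add: algebra_simps)
  then have "u = germ_z * w" by (rule germ_y_cancel)
  then show ?thesis by simp
qed

text \<open>Modulo \<open>y\<close>, \<open>f\<close> is a unit times a power of \<open>z\<close>,
  hence a nonzerodivisor. This supplies the hypothesis \<open>dvd\<close> of
  \<open>colength_mult\<close>.\<close>

lemma germ_y_regular:
  assumes f: "f = e * germ_z ^ k + germ_y * w" and e: "e dvd 1" and uv: "u * f = v * germ_y"
  shows "germ_y dvd u"
proof -
  from e obtain e' where e': "1 = e * e'" by auto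
  have "germ_z ^ k * (u * e) = germ_y * (v - u * w)"
    using uv by (simp add: f algebra_simps)
  then have "germ_y dvd germ_z ^ k * (u * e)" by simp
  moreover have "germ_y dvd germ_z ^ k * x \<Longrightarrow> germ_y dvd x" for x
    by (induction k) (auto simp: mult.assoc dest: germ_y_dvd_z_mult)
  ultimately have "germ_y dvd u * e * e'" using dvd_mult2 by blast
  moreover have "u * e * e' = u" using e' by (simp add: mult.assoc)
  ultimately show ?thesis by simp
qed

lemma germ_z_regular:
  assumes f: "f = e * germ_y ^ k + germ_z * w" and e: "e dvd 1" and uv: "u * f = v * germ_z"
  shows "germ_z dvd u"
proof -
  from e obtain e' where e': "1 = e * e'" by auto
  have "germ_y ^ k * (u * e) = germ_z * (v - u * w)"
    using uv by (simp add: f algebra_simps)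
  then have "germ_z dvd germ_y ^ k * (u * e)" by simp
  moreover have "germ_z dvd germ_y ^ k * x \<Longrightarrow> germ_z dvd x" for x
    by (induction k) (auto simp: mult.assoc dest: germ_z_dvd_y_mult)
  ultimately have "germ_z dvd u * e * e'" using dvd_mult2 by blast
  moreover have "u * e * e' = u" using e' by (simp add: mult.assoc)
  ultimately show ?thesis by simp
qed

abbreviation germ_colength :: "germ \<Rightarrow> germ \<Rightarrow> nat \<Rightarrow> bool" where
  "germ_colength \<equiv> colength (range germ_const)"

lemma germ_axis_diff: "germ_axis (F - G) = germ_axis F - germ_axis G"
  by (metis add_uminus_conv_diff germ_axis_add germ_axis_uminus)

text \<open>Two divisions: subtract the restriction to \<open>y = 0\<close> and divide by
  \<open>y\<close>, then subtract the value from that restriction and divide by \<open>z\<close>,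
  the latter through the swap.\<close>

lemma germ_decompose: "F - germ_const (germ_val F) \<in> pair_ideal germ_y germ_z"
proof -
  define c where "c = germ_const (germ_val F)"
  have "germ_axis (F - germ_axis F) = 0"
    by (simp add: germ_axis_diff germ_axis_axis)
  then obtain G where G: "F - germ_axis F = germ_y * G"
    using germ_y_dvd_iff_axis by (metis dvdE)
  have "germ_axis (germ_swap (germ_axis F) - c) = 0"
    by (simp add: germ_axis_diff germ_axis_const germ_axis_swap_axis c_def)
  then obtain H where "germ_swap (germ_axis F) - c = germ_y * H"
    using germ_y_dvd_iff_axis by (metis dvdE)
  then have "germ_swap (germ_axis F) = germ_y * H + c" by (simp add: algebra_simps)
  then have "germ_axis F = germ_swap (germ_y * H + c)" by (metis germ_swap_swap)
  then have "germ_axis F = germ_z * germ_swap H + c"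
    by (simp add: germ_swap_add germ_swap_mult germ_swap_y germ_swap_const c_def)
  with G have "F - c = G * germ_y + germ_swap H * germ_z" by (simp add: algebra_simps)
  then show ?thesis by (auto simp: pair_ideal_iff c_def)
qed

text \<open>The constants span the quotient by \<open>germ_decompose\<close>, and evaluation at the
  origin keeps \<open>1\<close> out of the ideal.\<close>

lemma germ_colength_y_z: "germ_colength germ_y germ_z 1"
proof -
  have "1 \<notin> pair_ideal germ_y germ_z"
  proof
    assume "1 \<in> pair_ideal germ_y germ_z"
    then obtain u v where "1 = u * germ_y + v * germ_z" by (auto simp: pair_ideal_iff)
    then have "germ_val 1 = germ_val (u * germ_y + v * germ_z)" by simp
    then show False by (simp add: germ_val_simps)
  qed
  then have "extends (range germ_const) (pair_ideal germ_y germ_z) (Suc 0)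
    {c * 1 + e | c e. c \<in> range germ_const \<and> e \<in> pair_ideal germ_y germ_z}"
    by (intro extends.intros)
  moreover have "F \<in> {c * 1 + e | c e. c \<in> range germ_const \<and> e \<in> pair_ideal germ_y germ_z}" for F
  proof -
    have "F = germ_const (germ_val F) * 1 + (F - germ_const (germ_val F))" by simp
    with germ_decompose[of F] show ?thesis by blast
  qed
  then have "{c * 1 + e | c e. c \<in> range germ_const \<and> e \<in> pair_ideal germ_y germ_z} = UNIV" by blast
  ultimately show ?thesis by (simp add: colength_def)
qed

lemma germ_colength_mult_z:
  assumes "f = e * germ_y ^ k + germ_z * w" "e dvd 1"
    and "germ_colength f germ_z m" "germ_colength f h n"
  shows "germ_colength f (germ_z * h) (n + m)"
  by (rule colength_mult) (use assms germ_z_regular germ_z_cancel in blast)+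

lemma germ_colength_mult_y:
  assumes "f = e * germ_z ^ k + germ_y * w" "e dvd 1"
    and "germ_colength f germ_y m" "germ_colength f h n"
  shows "germ_colength f (germ_y * h) (n + m)"
  by (rule colength_mult) (use assms germ_y_regular germ_y_cancel in blast)+

lemma germ_colength_y_z_power: "germ_colength germ_y (germ_z ^ k) k"
proof (induction k)
  case (Suc k)
  \<comment> \<open>The arguments write \<open>germ_y\<close> as
    \<open>1 * germ_y ^ 1 + germ_z * 0\<close>.\<close>
  from germ_colength_mult_z[of germ_y 1 1 0, OF _ _ germ_colength_y_z this] show ?case by simp
qed (simp add: colength_unit)

lemma germ_colength_z_y_power: "germ_colength germ_z (germ_y ^ k) k"
proof (induction k)
  case (Suc k)
  have "germ_colength germ_z germ_y 1" using germ_colength_y_z colength_swap by blast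
  from germ_colength_mult_y[of germ_z 1 1 0, OF _ _ this Suc] show ?case by simp
qed (simp add: colength_unit)

text \<open>Once the linear parts vanish, \<open>g\<close> becomes
  \<open>germ_y * germ_conic b c\<close> and \<open>f\<close> becomes
  \<open>germ_cubic a c\<close>.\<close>

definition germ_conic :: "complex \<Rightarrow> complex \<Rightarrow> germ" where
  "germ_conic b c = germ_z ^ 2 - germ_const c * germ_z - germ_const b * germ_y"

definition germ_cubic :: "complex \<Rightarrow> complex \<Rightarrow> germ" where
  "germ_cubic a c = - (germ_y ^ 2) - germ_const a * germ_y * germ_z + germ_const c * germ_z ^ 2 - germ_z ^ 3"

lemma germ_const_unit: "c \<noteq> 0 \<Longrightarrow> germ_const c dvd 1"
  by (metis dvdI germ_const_simps(2,4) right_inverse)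

lemma germ_z_minus_const_unit: "c \<noteq> 0 \<Longrightarrow> germ_z - germ_const c dvd 1"
  using germ_z_plus_const_unit[of "- c"] by (simp add: germ_const_simps)

lemma mult_dvd_1: "x dvd 1 \<Longrightarrow> y dvd 1 \<Longrightarrow> x * y dvd (1 :: 'a :: comm_ring_1)"
  by (metis mult_dvd_mono mult_1)

text \<open>For nonzero \<open>b\<close> the conic is smooth at the origin with parameter
  \<open>z\<close>, so the order in \<open>z\<close> of the eliminated cubic is counted:
  \<open>z ^ 2\<close> gives two, and each further linear factor gives one exactly if its constant
  vanishes.\<close>

lemma colength_cubic_conic:
  assumes b: "b \<noteq> 0"
  shows "germ_colength (germ_cubic a c) (germ_conic b c)
    (2 + (if c = 0 then 1 else 0) + (if b * b + a * b = c then 1 else 0))"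
proof -
  define A B C where "A = germ_const a" and "B = germ_const b" and "C = germ_const c"
  define D where "D = germ_const (b * b + a * b - c)"
  note defs = germ_conic_def germ_cubic_def A_def[symmetric] B_def[symmetric] C_def[symmetric]
  obtain B' where B': "1 = B * B'" using germ_const_unit[OF b] by (auto simp: B_def)
  have D: "D = B * B + A * B - C"
    using germ_const_simps(3)[of "b * b + a * b" "- c"] by (simp add: D_def A_def B_def C_def germ_const_simps)
  \<comment> \<open>Each factor \<open>z\<close> counts once: modulo \<open>z\<close> the conic is
    \<open>- B * y\<close>, so its ideal with \<open>z\<close> is that of \<open>y\<close> and
    \<open>z\<close>.\<close>
  have hz: "germ_colength (germ_conic b c) (germ_z * t) (Suc n)" if "germ_colength (germ_conic b c) t n" for t n
  proof -
    have Bu: "- B dvd 1" using germ_const_unit[OF b] by (simp add: B_def)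
    have conic: "germ_conic b c = (- B) * germ_y + (germ_z - C) * germ_z"
      unfolding defs by (simp add: algebra_simps power2_eq_square)
    have "germ_colength germ_z germ_y 1" using germ_colength_y_z colength_swap by blast
    then have "germ_colength germ_z (germ_conic b c) 1" using colength_cong[OF conic Bu] by blast
    then have "germ_colength (germ_conic b c) germ_z 1" using colength_swap by blast
    moreover have "germ_conic b c = (- B) * germ_y ^ 1 + germ_z * (germ_z - C)"
      using conic by (simp add: algebra_simps)
    ultimately show ?thesis
      using germ_colength_mult_z[of "germ_conic b c" "- B" 1 "germ_z - C" 1 t n] Bu that by simp
  qed
  have unit: "germ_colength (germ_conic b c) (e * t) n" if "germ_colength (germ_conic b c) t n" "e dvd 1" for e t n
    using that colength_cong[of "e * t" e t 0] by auto
  \<comment> \<open>The unit \<open>- 1\<close> carries the sign of the eliminated cubic and starts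
    the count at zero; the factors are then attached one by one.\<close>
  have zero: "germ_colength (germ_conic b c) (- 1) 0" by (rule colength_unit) simp
  have t1: "germ_colength (germ_conic b c) ((germ_z + D) * (- 1)) (if b * b + a * b = c then 1 else 0)"
  proof (cases "b * b + a * b = c")
    case True
    then have "D = 0" by (simp add: D_def germ_const_simps)
    with hz[OF zero] True show ?thesis by simp
  next
    case False
    then have "germ_z + D dvd 1" unfolding D_def by (intro germ_z_plus_const_unit) simp
    from unit[OF zero this] False show ?thesis by simp
  qed
  have t2: "germ_colength (germ_conic b c) ((germ_z - C) * ((germ_z + D) * (- 1)))
      ((if c = 0 then 1 else 0) + (if b * b + a * b = c then 1 else 0))"
  proof (cases "c = 0")
    case True
    with hz[OF t1] show ?thesis by (simp add: C_def germ_const_simps)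
  next
    case False
    from unit[OF t1 germ_z_minus_const_unit[OF this]] False show ?thesis by (simp add: C_def)
  qed
  have t3: "germ_colength (germ_conic b c) (germ_z * (germ_z * ((germ_z - C) * ((germ_z + D) * (- 1)))))
      (2 + (if c = 0 then 1 else 0) + (if b * b + a * b = c then 1 else 0))"
    using hz[OF hz[OF t2]] by simp
  \<comment> \<open>With \<open>t = z * (z - C)\<close> the conic is \<open>t - B * y\<close>.
    Substituting \<open>B * y = t - conic\<close> in \<open>B * B\<close> times the cubic gives both
    the product and the multiplier of the conic.\<close>
  have "germ_z * (germ_z * ((germ_z - C) * ((germ_z + D) * (- 1)))) =
    (B * B) * germ_cubic a c + (- (B * germ_y + germ_z * (germ_z - C) + A * B * germ_z)) * germ_conic b c"
    unfolding defs D by (simp add: algebra_simps power2_eq_square power3_eq_cube)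
  moreover have "B * B dvd 1" using mult_dvd_1 germ_const_unit[OF b] by (simp add: B_def)
  ultimately have "germ_colength (germ_conic b c) (germ_cubic a c)
      (2 + (if c = 0 then 1 else 0) + (if b * b + a * b = c then 1 else 0))"
    using colength_cong t3 by blast
  then show ?thesis using colength_swap by blast
qed

lemma cubic_eq_mod_z: "germ_cubic a c = (- 1) * germ_y ^ 2 + germ_z *
    (germ_const c * germ_z - germ_const a * germ_y - germ_z ^ 2)"
  by (simp add: germ_cubic_def algebra_simps power2_eq_square power3_eq_cube)

text \<open>On \<open>z = 0\<close> the cubic is \<open>- y ^ 2\<close>, and \<open>y ^ 2\<close>
  has colength two there.\<close>

lemma colength_cubic_z: "germ_colength (germ_cubic a c) germ_z 2"
proof -
  have "germ_colength germ_z (germ_y ^ 2) 2" by (rule germ_colength_z_y_power)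
  moreover have "germ_y ^ 2 = (- 1) * germ_cubic a c +
      (germ_const c * germ_z - germ_const a * germ_y - germ_z ^ 2) * germ_z"
    unfolding cubic_eq_mod_z by (simp add: algebra_simps power2_eq_square)
  ultimately have "germ_colength germ_z (germ_cubic a c) 2"
    using colength_cong[of "germ_y ^ 2" "- 1" "germ_cubic a c" _ germ_z] by simp
  then show ?thesis using colength_swap by blast
qed

text \<open>For \<open>b = 0\<close> the conic splits as \<open>z * (z - c)\<close>. If
  \<open>c = 0\<close>, the line \<open>z = 0\<close> is counted twice; otherwise the second factor
  is a unit.\<close>

lemma colength_cubic_conic_0:
  "germ_colength (germ_cubic a c) (germ_conic 0 c) (if c = 0 then 4 else 2)"
proof (cases "c = 0")
  case True
  then have "germ_conic 0 c = germ_z * germ_z" by (simp add: germ_conic_def germ_const_simps power2_eq_square)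
  moreover have "germ_colength (germ_cubic a c) (germ_z * germ_z) (2 + 2)"
    by (rule germ_colength_mult_z[OF cubic_eq_mod_z]) (simp_all add: colength_cubic_z)
  ultimately show ?thesis using True by simp
next
  case False
  have "germ_conic 0 c = (germ_z - germ_const c) * germ_z + 0 * germ_cubic a c"
    by (simp add: germ_conic_def germ_const_simps power2_eq_square algebra_simps)
  from colength_cong[OF this germ_z_minus_const_unit[OF False]] colength_cubic_z
  have "germ_colength (germ_cubic a c) (germ_conic 0 c) 2" by blast
  with False show ?thesis by simp
qed

text \<open>On \<open>y = 0\<close> the cubic is \<open>z ^ 2 * (c - z)\<close>. For
  \<open>c = 0\<close> the last factor is no unit and joins the power of \<open>z\<close>; hence the
  exponents \<open>2\<close> and \<open>3\<close>.\<close>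

lemma cubic_eq_mod_y: "germ_cubic a c = (if c = 0 then - 1 else germ_const c - germ_z) * germ_z ^ (if c = 0 then 3 else 2) +
    germ_y * (- germ_y - germ_const a * germ_z)"
  by (simp add: germ_cubic_def algebra_simps power2_eq_square power3_eq_cube germ_const_simps)

lemma cubic_unit_mod_y: "(if c = 0 then - 1 else germ_const c - germ_z) dvd 1"
  using germ_z_minus_const_unit[of c] minus_dvd_iff[of "germ_z - germ_const c" 1] by auto

lemma colength_cubic_y: "germ_colength (germ_cubic a c) germ_y (if c = 0 then 3 else 2)"
proof -
  let ?k = "if c = 0 then 3 else 2 :: nat" and ?e = "if c = 0 then - 1 else germ_const c - germ_z"
  have "germ_colength germ_y (germ_z ^ ?k) ?k" by (rule germ_colength_y_z_power)
  moreover have "germ_cubic a c = ?e * germ_z ^ ?k + (- germ_y - germ_const a * germ_z) * germ_y"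
    using cubic_eq_mod_y by (simp add: mult.commute)
  ultimately have "germ_colength germ_y (germ_cubic a c) ?k"
    using colength_cong cubic_unit_mod_y by blast
  then show ?thesis using colength_swap by blast
qed

lemma colength_cubic_y_conic:
  assumes "germ_colength (germ_cubic a c) (germ_conic b c) n"
  shows "germ_colength (germ_cubic a c) (germ_y * germ_conic b c) (n + (if c = 0 then 3 else 2))"
  by (rule germ_colength_mult_y[OF cubic_eq_mod_y cubic_unit_mod_y colength_cubic_y assms])


section \<open>The intersection index of polynomials\<close>

text \<open>Uniqueness of \<open>dimension\<close> is available over a subfield; the constants
  supply one, and their image serves as the scalars of the quotient.\<close>

lemma subfield_germ_const: "subfield (range germ_const) germ_ring"
proof -
  interpret R: cring germ_ring by (rule cring_germ_ring)
  note simps = germ_ring_def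
  have "subcring (range germ_const) germ_ring"
  proof (rule R.subcringI'[OF R.subringI])
    show "\<one>\<^bsub>germ_ring\<^esub> \<in> range germ_const"
      unfolding simps one_type_algebra using germ_const_simps(2) by (metis rangeI)
    show "\<ominus>\<^bsub>germ_ring\<^esub> h \<in> range germ_const" if "h \<in> range germ_const" for h
      using that unfolding simps uminus_type_algebra by (auto simp flip: germ_const_simps)
    show "h \<otimes>\<^bsub>germ_ring\<^esub> h' \<in> range germ_const" "h \<oplus>\<^bsub>germ_ring\<^esub> h' \<in> range germ_const"
      if "h \<in> range germ_const" "h' \<in> range germ_const" for h h'
      using that unfolding simps mult_type_algebra add_type_algebra by (auto simp flip: germ_const_simps)
  qed (simp add: simps)
  moreover have "Units (germ_ring\<lparr>carrier := range germ_const\<rparr>) = range germ_const - {\<zero>\<^bsub>germ_ring\<^esub>}"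
  proof (intro equalityI subsetI)
    fix x assume "x \<in> Units (germ_ring\<lparr>carrier := range germ_const\<rparr>)"
    then obtain y where "x \<in> range germ_const" "y * x = 1"
      by (auto simp: Units_def simps)
    then show "x \<in> range germ_const - {\<zero>\<^bsub>germ_ring\<^esub>}" by (auto simp: simps)
  next
    fix x assume "x \<in> range germ_const - {\<zero>\<^bsub>germ_ring\<^esub>}"
    then obtain c where "x = germ_const c" "x \<noteq> 0" by (auto simp: simps)
    then have x: "x = germ_const c" "c \<noteq> 0" using germ_const_simps(1) by auto
    then have "germ_const (inverse c) * x = 1" "x * germ_const (inverse c) = 1"
      by (simp_all add: germ_const_simps flip: germ_const_simps(4))
    then show "x \<in> Units (germ_ring\<lparr>carrier := range germ_const\<rparr>)"
      using x(1) unfolding Units_def by (auto simp: simps)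
  qed
  ultimately show ?thesis by (rule R.subfieldI)
qed

text \<open>The chain of length \<open>n\<close> shows that \<open>n\<close> is a dimension, and the
  subfield of scalars makes it the only one, so the description operator returns it.\<close>

lemma intersection_index_eqI:
  assumes n: "germ_colength (germ_of_poly f) (germ_of_poly g) n" and "n \<noteq> 0"
  shows "intersection_index f g = enat n"
proof -
  define I where "I = genideal germ_ring {germ_of_poly f, germ_of_poly g}"
  have I: "I = pair_ideal (germ_of_poly f) (germ_of_poly g)"
    unfolding I_def germ_ring_def by (rule genideal_pair)
  interpret R: cring germ_ring by (rule cring_germ_ring)
  have id: "ideal I germ_ring" unfolding I_def by (rule R.genideal_ideal) (simp add: germ_ring_def)
  interpret ideal I germ_ring by (rule id)
  define Q where "Q = germ_ring Quot I"
  define K where "K = range (\<lambda>c. I +>\<^bsub>germ_ring\<^esub> germ_const c)"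
  interpret h: ring_hom_ring germ_ring Q "\<lambda>c. I +>\<^bsub>germ_ring\<^esub> c"
    unfolding Q_def by (rule rcos_ring_hom_ring)
  have carrier: "carrier Q = (\<lambda>c. I +>\<^bsub>germ_ring\<^esub> c) ` UNIV"
    unfolding Q_def FactRing_def partial_object.select_convs A_RCOSETS_def'
    by (auto simp: germ_ring_def)
  have K: "K = (\<lambda>c. I +>\<^bsub>germ_ring\<^esub> c) ` range germ_const" by (simp add: K_def image_image)
  have dim: "h.S.dimension n K (carrier Q)"
    unfolding carrier unfolding K Q_def
  proof (rule dimension_quot_of_extends[where ?'a = germ, folded germ_ring_def])
    show "extends (range germ_const) I n UNIV" using n by (simp add: I colength_def)
  qed (rule id)
  \<comment> \<open>The image of the constants is a subfield only in a nonzero quotient. Were the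
    quotient zero, the ideal would be everything and the chain would have length zero.\<close>
  have "\<one>\<^bsub>Q\<^esub> \<noteq> \<zero>\<^bsub>Q\<^esub>"
  proof
    assume eq: "\<one>\<^bsub>Q\<^esub> = \<zero>\<^bsub>Q\<^esub>"
    then have "I +>\<^bsub>germ_ring\<^esub> 1 = I"
      unfolding Q_def FactRing_def by (simp add: germ_ring_def)
    moreover have "0 + 1 \<in> I +>\<^bsub>germ_ring\<^esub> 1"
      using zero_closed unfolding a_r_coset_def' germ_ring_def by fastforce
    ultimately have "\<one>\<^bsub>germ_ring\<^esub> \<in> I" by (simp add: germ_ring_def)
    then have "I = UNIV" using one_imp_carrier by (simp add: germ_ring_def)
    with n have "extends (range germ_const) UNIV n UNIV" by (simp add: colength_def I)
    from extends_UNIV[OF this] \<open>n \<noteq> 0\<close> show False by simp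
  qed
  then have "subfield K Q"
    unfolding K using h.img_is_subfield(2)[OF subfield_germ_const] by blast
  then have "m = n" if "h.S.dimension m K (carrier Q)" for m
    using h.S.dimension_is_inj[OF _ that dim] by blast
  with dim have "(THE m. h.S.dimension m K (carrier Q)) = n" by (intro the_equality) 
  moreover have "\<exists>m. h.S.dimension m K (carrier Q)" using dim by blast
  ultimately show ?thesis
    unfolding intersection_index_def Let_def I_def[symmetric] Q_def[symmetric] K_def[symmetric] by simp
qed

section \<open>Germs of polynomials\<close>

lemma germ_of_poly_add: "germ_of_poly (p + q) = germ_of_poly p + germ_of_poly q"
  by transfer (simp add: germ_rel_def eval_yz_add holomorphic_at_0_eval holomorphic_at_0_add)

lemma germ_of_poly_uminus: "germ_of_poly (- p) = - germ_of_poly p"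
  by transfer (simp add: germ_rel_def eval_yz_uminus holomorphic_at_0_eval holomorphic_at_0_uminus)

lemma germ_of_poly_diff: "germ_of_poly (p - q) = germ_of_poly p - germ_of_poly q"
  by (metis add_uminus_conv_diff germ_of_poly_add germ_of_poly_uminus)

lemma germ_relI:
  assumes "holomorphic_at_0 F" and eq: "\<And>p. F p = G p"
  shows "germ_rel F G"
proof -
  from eq have "F = G" by (rule ext)
  with assms(1) show ?thesis by (simp add: germ_rel_def)
qed

lemma germ_of_poly_single:
  "germ_of_poly (Poly_Mapping.single (i, j) c) = germ_const c * germ_y ^ i * germ_z ^ j"
proof -
  have *: "germ_of_poly (Poly_Mapping.single (i, j) (c * d)) =
     germ_const c * germ_of_poly (Poly_Mapping.single (i, j) d)" for i j c d
    by transfer (rule germ_relI; simp add: holomorphic_at_0_eval eval_yz_single)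
  have y: "germ_of_poly (Poly_Mapping.single (Suc i, j) 1) = germ_y * germ_of_poly (Poly_Mapping.single (i, j) 1)" for i j
    by transfer (rule germ_relI; simp add: holomorphic_at_0_eval eval_yz_single)
  have z: "germ_of_poly (Poly_Mapping.single (i, Suc j) 1) = germ_z * germ_of_poly (Poly_Mapping.single (i, j) 1)" for i j
    by transfer (rule germ_relI; simp add: holomorphic_at_0_eval eval_yz_single)
  have one: "germ_of_poly (Poly_Mapping.single (0, 0) 1) = 1"
    by transfer (rule germ_relI; simp add: holomorphic_at_0_eval eval_yz_single)
  have zj: "germ_of_poly (Poly_Mapping.single (0, j) 1) = germ_z ^ j"
    by (induction j) (simp_all add: one z)
  have "germ_of_poly (Poly_Mapping.single (i, j) 1) = germ_y ^ i * germ_z ^ j"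
    by (induction i) (simp_all add: y zj mult.assoc)
  then show ?thesis using *[of i j c 1] by (simp add: mult.assoc)
qed

section \<open>Homogenization and lowest degree\<close>

lemma lookup_homogenize:
  "Poly_Mapping.lookup (homogenize d p) (k, i, j) = (if k = d - (i + j) then Poly_Mapping.lookup p (i, j) else 0)"
proof -
  have "Poly_Mapping.lookup (homogenize d p) (k, i, j) =
    (\<Sum>q\<in>Poly_Mapping.keys p. if q = (i, j) then (if k = d - (i + j) then Poly_Mapping.lookup p (i, j) else 0) else 0)"
    unfolding homogenize_def lookup_sum case_prod_unfold lookup_single
    by (intro sum.cong) (auto simp: when_def)
  then show ?thesis by (simp add: in_keys_iff)
qed

lemma lookup_dehomogenize:
  "Poly_Mapping.lookup (dehomogenize P) (i, j) =
    (\<Sum>q\<in>Poly_Mapping.keys P. if snd q = (i, j) then Poly_Mapping.lookup P q else 0)"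
  unfolding dehomogenize_def lookup_sum case_prod_unfold lookup_single
  by (intro sum.cong) (auto simp: when_def)

text \<open>The exponent of \<open>x\<close> is a function of \<open>(i, j)\<close>, also where the
  subtraction truncates, so no two monomials merge and setting \<open>x = 1\<close> restores each
  coefficient.\<close>

lemma dehomogenize_homogenize: "dehomogenize (homogenize d p) = p"
proof (rule poly_mapping_eqI)
  fix q :: "nat \<times> nat"
  obtain i j where q: "q = (i, j)" by (cases q)
  have "Poly_Mapping.lookup (dehomogenize (homogenize d p)) (i, j) =
    (\<Sum>q\<in>Poly_Mapping.keys (homogenize d p). if q = (d - (i + j), i, j) then Poly_Mapping.lookup p (i, j) else 0)"
    unfolding lookup_dehomogenize
    by (intro sum.cong) (auto simp: lookup_homogenize in_keys_iff split: if_splits)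
  also have "\<dots> = Poly_Mapping.lookup p (i, j)"
    by (simp add: in_keys_iff lookup_homogenize)
  finally show "Poly_Mapping.lookup (dehomogenize (homogenize d p)) q = Poly_Mapping.lookup p q"
    by (simp add: q)
qed

lemma lookup_hom_component:
  "Poly_Mapping.lookup (hom_component d p) (i, j) = (if i + j = d then Poly_Mapping.lookup p (i, j) else 0)"
proof -
  have "Poly_Mapping.lookup (hom_component d p) (i, j) =
    (\<Sum>q\<in>{q \<in> Poly_Mapping.keys p. fst q + snd q = d}. if q = (i, j) then Poly_Mapping.lookup p (i, j) else 0)"
    unfolding hom_component_def lookup_sum case_prod_unfold lookup_single
    by (intro sum.cong) (auto simp: when_def)
  then show ?thesis by (auto simp: in_keys_iff)
qed

text \<open>A nonzero coefficient makes its homogeneous component nonzero and so bounds the infimum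
  from above.\<close>

lemma lookup_eq_0_of_lowest_degree:
  assumes "enat (i + j) < lowest_degree p"
  shows "Poly_Mapping.lookup p (i, j) = 0"
proof (rule ccontr)
  assume "Poly_Mapping.lookup p (i, j) \<noteq> 0"
  then have "hom_component (i + j) p \<noteq> 0"
    using lookup_hom_component[of "i + j" p i j] by auto
  then have "lowest_degree p \<le> enat (i + j)"
    unfolding lowest_degree_def by (intro Inf_lower) auto
  with assms show False by simp
qed

text \<open>For \<open>b = 0\<close> the total is \<open>4 + 3\<close> or \<open>2 + 2\<close>. For
  nonzero \<open>b\<close> it is \<open>4\<close> or \<open>5\<close> if \<open>c\<close> is nonzero
  and \<open>6\<close> or \<open>7\<close> if \<open>c = 0\<close>, where
  \<open>b * b + a * b = 0\<close> means \<open>b = - a\<close>.\<close>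

lemma colength_family:
  fixes a b c :: complex
  shows "\<exists>n. germ_colength (germ_cubic a c) (germ_y * germ_conic b c) n \<and> 4 \<le> n \<and> n \<le> 7 \<and>
    (c = 0 \<and> (b = 0 \<or> b = - a) \<longrightarrow> n = 7)"
proof (cases "b = 0")
  case True
  then show ?thesis
    using colength_cubic_y_conic[OF colength_cubic_conic_0[of a c]] by (auto split: if_splits)
next
  case False
  note n = colength_cubic_y_conic[OF colength_cubic_conic[OF False, of a c]]
  show ?thesis
    by (rule exI, rule conjI[OF n]) auto
qed

theorem theorem5p3:
  fixes C03_10 C03_01 C03_11 C12_10 C12_20 C12_01 C12_11 :: complex
    and f g :: poly_yz
    and A :: poly_xyz and \<omega> :: form_xyz
  assumes f: "f = - const_yz C03_10 * var_y - var_y ^ 2 - const_yz C03_01 * var_z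
                  - const_yz C03_11 * var_y * var_z + const_yz C12_11 * var_z ^ 2 - var_z ^ 3"
    and g: "g = - const_yz C12_10 * var_y - const_yz C12_20 * var_y ^ 2 - const_yz C12_01 * var_z
                  - const_yz C12_11 * var_y * var_z + var_y * var_z ^ 2"
    and omega: "\<omega> = (A, homogenize 3 f, homogenize 3 g)" "projective_form 3 \<omega>"
    and mult: "alg_multiplicity_100 \<omega> = 2"
  shows "4 \<le> intersection_index f g \<and> intersection_index f g \<le> 7 \<and>
    (hom_component 1 f = 0 \<and> hom_component 1 g = 0 \<and>
       C12_11 = 0 \<and> C12_20 = - C03_11 \<and> - C03_11 \<noteq> 0
     \<longrightarrow> intersection_index f g = 7) \<and>
    (hom_component 1 f = 0 \<and> hom_component 1 g = 0 \<and>
       C12_20 = 0 \<and> C12_11 = 0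
     \<longrightarrow> intersection_index f g = 7)"
proof -
  have f_eq: "f = - Poly_Mapping.single (1, 0) C03_10 - Poly_Mapping.single (2, 0) 1
      - Poly_Mapping.single (0, 1) C03_01 - Poly_Mapping.single (1, 1) C03_11
      + Poly_Mapping.single (0, 2) C12_11 - Poly_Mapping.single (0, 3) 1"
    unfolding f by (simp add: const_yz_def var_y_def var_z_def mult_single power2_eq_square power3_eq_cube
        numeral_2_eq_2 numeral_3_eq_3)
  have g_eq: "g = - Poly_Mapping.single (1, 0) C12_10 - Poly_Mapping.single (2, 0) C12_20
      - Poly_Mapping.single (0, 1) C12_01 - Poly_Mapping.single (1, 1) C12_11
      + Poly_Mapping.single (1, 2) 1"
    unfolding g by (simp add: const_yz_def var_y_def var_z_def mult_single power2_eq_square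
        numeral_2_eq_2)
  \<comment> \<open>Setting \<open>x = 1\<close> undoes the homogenization, so the multiplicity is a
    condition on \<open>f\<close> and \<open>g\<close> alone.\<close>
  have "min (lowest_degree f) (lowest_degree g) = 2"
    using mult by (simp add: omega(1) alg_multiplicity_100_def dehomogenize_homogenize)
  then have "2 \<le> lowest_degree f" "2 \<le> lowest_degree g" by (metis min.cobounded1 min.cobounded2)+
  moreover have "enat (Suc 0) < 2" by (simp add: numeral_eq_enat)
  ultimately have "enat (i + j) < lowest_degree f" "enat (i + j) < lowest_degree g"
    if "i + j = Suc 0" for i j
    using that by (metis order.strict_trans2)+
  then have lin: "Poly_Mapping.lookup f (i, j) = 0" "Poly_Mapping.lookup g (i, j) = 0"
    if "i + j = Suc 0" for i j
    using that lookup_eq_0_of_lowest_degree by blast+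
  \<comment> \<open>The exponents \<open>(1, 0)\<close> and \<open>(0, 1)\<close> pick out exactly
    the four parameters of the linear parts.\<close>
  have lin0: "C03_10 = 0" "C03_01 = 0" "C12_10 = 0" "C12_01 = 0"
    using lin[of 1 0] lin[of 0 1] unfolding f_eq g_eq
    by (simp_all add: lookup_add lookup_minus lookup_single)
  have "germ_of_poly f = germ_cubic C03_11 C12_11"
    unfolding f_eq lin0
    by (simp add: germ_of_poly_add germ_of_poly_diff germ_of_poly_uminus germ_of_poly_single
        germ_const_simps germ_cubic_def)
  moreover have "germ_of_poly g = germ_y * germ_conic C12_20 C12_11"
    unfolding g_eq lin0
    by (simp add: germ_of_poly_add germ_of_poly_diff germ_of_poly_uminus germ_of_poly_single
        germ_const_simps germ_conic_def algebra_simps power2_eq_square)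
  ultimately obtain n where n: "germ_colength (germ_of_poly f) (germ_of_poly g) n" "4 \<le> n" "n \<le> 7"
    and n7: "C12_11 = 0 \<and> (C12_20 = 0 \<or> C12_20 = - C03_11) \<longrightarrow> n = 7"
    using colength_family[of C03_11 C12_11 C12_20] by auto
  \<comment> \<open>The lower bound \<open>4\<close> ensures that \<open>n\<close> is nonzero, as
    \<open>intersection_index_eqI\<close> requires.\<close>
  from n have "intersection_index f g = enat n" by (intro intersection_index_eqI) auto
  with n n7 show ?thesis by (auto simp: numeral_eq_enat)
qed

end
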